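(* Let $0<s<1$ and $0\le\alpha<1-s$. Let $T$ be a $(C,\alpha)$-bounded operator on a complex Banach space $X$ with $\overline{(I-T)X}=X$, and let $x\in X$. Then the following assertions are equivalent: (i) $x\in\operatorname{Ran}(I-T)^s$. (ii) The series $\sum_{n=1}^\infty\frac{1}{n^{1-s}}T^nx$ converges in norm (or, equivalently, converges weakly). If (i) or (ii) holds, then $$(I-T)^{-s}x=\sum_{n=0}^\infty k^s(n)T^nx.$$
   Context: For $\alpha\in\mathbb R$: $k^\alpha(0)=1$, $k^\alpha(n)=\frac{\alpha(\alpha+1)\cdots(\alpha+n-1)}{n!}$ for $n\ge1$ (coefficients of $(1-z)^{-\alpha}$). For $T\in\mathcal B(X)$: $\Delta^{-\alpha}\mathcal T(n)=\sum_{j=0}^nk^\alpha(n-j)T^j$, and $T$ is $(C,\alpha)$-bounded if $\sup_n\|\Delta^{-\alpha}\mathcal T(n)\|/k^{\alpha+1}(n)<\infty$. For $0<s<1$, the operator $(I-T)^s\in\mathcal B(X)$ is defined by the functional calculus applied to $(1-z)^s=\sum_nk^{-s}(n)z^n$, that is, $(I-T)^s:=\sum_{n=0}^\infty D^\alpha k^{-s}(n)\,\Delta^{-\alpha}\mathcal T(n)$ (absolutely convergent), where $D^\alpha f(n)=\sum_{j=n}^\infty k^{-\alpha}(j-n)f(j)$. Under the hypotheses $I-T$ and $(I-T)^s$ are injective, and $(I-T)^{-s}:=((I-T)^s)^{-1}$ with domain $\operatorname{Ran}(I-T)^s$. *)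

theory Defs
  imports "HOL-Analysis.Analysis"
begin

text \<open>The distribution only has real normed spaces; a complex Banach space is a real one carrying
  a compatible complex scalar multiplication.\<close>

class complex_normed_vector = real_normed_vector +
  fixes scaleC :: "complex \<Rightarrow> 'a \<Rightarrow> 'a"  (infixr \<open>*\<^sub>C\<close> 75)
  assumes scaleC_add_right: "a *\<^sub>C (x + y) = a *\<^sub>C x + a *\<^sub>C y"
    and scaleC_add_left: "(a + b) *\<^sub>C x = a *\<^sub>C x + b *\<^sub>C x"
    and scaleC_scaleC: "a *\<^sub>C (b *\<^sub>C x) = (a * b) *\<^sub>C x"
    and scaleR_scaleC: "r *\<^sub>R x = complex_of_real r *\<^sub>C x"
    and norm_scaleC: "norm (a *\<^sub>C x) = cmod a * norm x"

class complex_banach = complex_normed_vector + banach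

instantiation complex :: complex_banach
begin

definition scaleC_complex :: "complex \<Rightarrow> complex \<Rightarrow> complex" where
  "scaleC_complex a z = a * z"

instance
  by standard (auto simp: scaleC_complex_def algebra_simps norm_mult scaleR_conv_of_real)

end

text \<open>Bounded complex-linear maps are the bounded real-linear maps that commute with complex
  scalars; the operator norm is the same.\<close>

definition complex_linear ::
    "('a::complex_normed_vector \<Rightarrow>\<^sub>L 'b::complex_normed_vector) \<Rightarrow> bool" where
  "complex_linear T \<longleftrightarrow> (\<forall>c x. T (c *\<^sub>C x) = c *\<^sub>C T x)"

primrec blinfun_pow ::
    "('a::real_normed_vector \<Rightarrow>\<^sub>L 'a) \<Rightarrow> nat \<Rightarrow> 'a \<Rightarrow>\<^sub>L 'a" where
  "blinfun_pow T 0 = id_blinfun"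
| "blinfun_pow T (Suc n) = T o\<^sub>L blinfun_pow T n"

lemma blinfun_pow_apply: "blinfun_apply (blinfun_pow T n) x = (blinfun_apply T ^^ n) x"
  by (induction n) auto

definition cesaro_kernel :: "real \<Rightarrow> nat \<Rightarrow> real" where
  "cesaro_kernel \<alpha> n = pochhammer \<alpha> n / fact n"

definition cesaro_sum ::
    "real \<Rightarrow> ('a::real_normed_vector \<Rightarrow>\<^sub>L 'a) \<Rightarrow> nat \<Rightarrow> 'a \<Rightarrow>\<^sub>L 'a" where
  "cesaro_sum \<alpha> T n = (\<Sum>j=0..n. cesaro_kernel \<alpha> (n - j) *\<^sub>R blinfun_pow T j)"

definition cesaro_bounded :: "real \<Rightarrow> ('a::real_normed_vector \<Rightarrow>\<^sub>L 'a) \<Rightarrow> bool" where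
  "cesaro_bounded \<alpha> T \<longleftrightarrow>
     bdd_above (range (\<lambda>n. norm (cesaro_sum \<alpha> T n) / cesaro_kernel (\<alpha> + 1) n))"

text \<open>The sum over \<open>j \<ge> n\<close> of \<open>cesaro_kernel (-\<alpha>) (j - n) * f j\<close>, re-indexed by \<open>i = j - n\<close>.\<close>

definition weyl_difference :: "real \<Rightarrow> (nat \<Rightarrow> real) \<Rightarrow> nat \<Rightarrow> real" where
  "weyl_difference \<alpha> f n = (\<Sum>i. cesaro_kernel (- \<alpha>) i * f (n + i))"

text \<open>\<open>(I - T)\<^sup>s\<close> for a \<open>(C,\<alpha>)\<close>-bounded \<open>T\<close>; the series is taken in operator norm.\<close>

definition frac_power ::
    "real \<Rightarrow> real \<Rightarrow> ('a::real_normed_vector \<Rightarrow>\<^sub>L 'a) \<Rightarrow> 'a \<Rightarrow>\<^sub>L 'a" where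
  "frac_power \<alpha> s T =
     (\<Sum>n. weyl_difference \<alpha> (cesaro_kernel (- s)) n *\<^sub>R cesaro_sum \<alpha> T n)"

text \<open>\<open>(I - T)\<^sup>-\<^sup>s\<close>, meaningful on the range of \<open>(I - T)\<^sup>s\<close> when the latter is injective.\<close>

definition frac_power_inv ::
    "real \<Rightarrow> real \<Rightarrow> ('a::real_normed_vector \<Rightarrow>\<^sub>L 'a) \<Rightarrow> 'a \<Rightarrow> 'a" where
  "frac_power_inv \<alpha> s T = the_inv (blinfun_apply (frac_power \<alpha> s T))"

definition weakly_convergent :: "(nat \<Rightarrow> 'a::complex_normed_vector) \<Rightarrow> bool" where
  "weakly_convergent u \<longleftrightarrow>
     (\<exists>y. \<forall>\<phi> :: 'a \<Rightarrow>\<^sub>L complex. complex_linear \<phi> \<longrightarrow> (\<lambda>N. \<phi> (u N)) \<longlonglongrightarrow> \<phi> y)"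

definition weighted_partial_sum ::
    "real \<Rightarrow> ('a::real_normed_vector \<Rightarrow>\<^sub>L 'a) \<Rightarrow> 'a \<Rightarrow> nat \<Rightarrow> 'a" where
  "weighted_partial_sum s T x N =
     (\<Sum>n=1..N. (1 / real n powr (1 - s)) *\<^sub>R blinfun_pow T n x)"

end

theory Submission
  imports Defs
begin

text \<open>Write \<open>k\<^sup>a\<close> for \<open>cesaro_kernel a\<close>. For a \<open>(C,\<alpha>)\<close>-bounded \<open>T\<close> the series
  \<open>\<Sum>m. k\<^sup>-\<^sup>s(m) T\<^sup>m\<close> converges in operator norm to \<open>A = (I - T)\<^sup>s\<close>, though not absolutely in general.
  With \<open>P\<^sub>N = (\<Sum>n\<le>N. k\<^sup>s(n) T\<^sup>n)\<close> one gets \<open>P\<^sub>N A = I - R\<^sub>N\<close>, where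
  \<open>R\<^sub>N = (\<Sum>i. r\<^sub>N(i) T\<^bsup>N + 1 + i\<^esup>)\<close> has explicit positive decreasing coefficients
  \<open>r\<^sub>N(i) = s k\<^sup>s\<^sup>+\<^sup>1(N) k\<^sup>1\<^sup>-\<^sup>s(i) / (N + 1 + i)\<close>.
  Boundedness of the Cesaro means yields
  \<open>\<parallel>T\<^bsup>N + 1\<^esup> + \<dots> + T\<^bsup>N + 1 + i\<^esup>\<parallel> \<le> C (N + 1 + i)\<^sup>\<alpha> (i + 1)\<^sup>1\<^sup>-\<^sup>\<alpha>\<close>, so summation by parts bounds
  \<open>\<parallel>R\<^sub>N\<parallel>\<close> uniformly, precisely because \<open>\<alpha> < 1 - s\<close>. On the dense range of \<open>I - T\<close> the same
  estimate gives \<open>R\<^sub>N \<rightarrow> 0\<close>, hence \<open>R\<^sub>N \<rightarrow> 0\<close> strongly. Therefore \<open>A\<close> is injective and \<open>P\<^sub>N A y \<rightarrow> y\<close>;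
  conversely, if \<open>P\<^sub>N x\<close> converges weakly to \<open>y\<close>, then \<open>A P\<^sub>N x = P\<^sub>N A x \<rightarrow> x\<close> forces \<open>A y = x\<close> by the
  Hahn-Banach theorem.\<close>

section \<open>Cesaro kernels\<close>

lemma cesaro_kernel_0 [simp]: "cesaro_kernel a 0 = 1"
  by (simp add: cesaro_kernel_def)

lemma cesaro_kernel_Suc:
  "cesaro_kernel a (Suc n) = (a + real n) / (real n + 1) * cesaro_kernel a n"
  by (simp add: cesaro_kernel_def pochhammer_Suc field_simps)

lemma cesaro_kernel_lower_Suc:
  "cesaro_kernel (a - 1) (Suc n) = (a - 1) / (real n + 1) * cesaro_kernel a n"
  by (simp add: cesaro_kernel_def pochhammer_rec field_simps)

lemma cesaro_kernel_raise:
  "a * cesaro_kernel (a + 1) n = (a + real n) * cesaro_kernel a n"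
  using pochhammer_rec[of a n] pochhammer_Suc[of a n]
  by (simp add: cesaro_kernel_def field_simps)

lemma cesaro_kernel_diff:
  "cesaro_kernel a (Suc n) - cesaro_kernel a n = cesaro_kernel (a - 1) (Suc n)"
  unfolding cesaro_kernel_lower_Suc cesaro_kernel_Suc[of a] by (simp add: field_simps)

lemma cesaro_kernel_1 [simp]: "cesaro_kernel 1 n = 1"
  by (induction n) (simp_all add: cesaro_kernel_Suc)

lemma cesaro_kernel_convolution:
  "(\<Sum>j\<le>n. cesaro_kernel a j * cesaro_kernel b (n - j)) = cesaro_kernel (a + b) n"
proof -
  have k: "cesaro_kernel c m = (- 1) ^ m * (- c gchoose m)" for c m
    by (simp add: cesaro_kernel_def gbinomial_pochhammer)
  have "(\<Sum>j\<le>n. cesaro_kernel a j * cesaro_kernel b (n - j))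
      = (\<Sum>j\<le>n. (- 1) ^ n * ((- a gchoose j) * (- b gchoose (n - j))))"
  proof (intro sum.cong refl)
    fix j assume "j \<in> {..n}"
    then have "(- 1) ^ n = (- 1) ^ j * (- 1 :: real) ^ (n - j)"
      by (simp flip: power_add)
    then show "cesaro_kernel a j * cesaro_kernel b (n - j)
        = (- 1) ^ n * ((- a gchoose j) * (- b gchoose (n - j)))"
      by (simp only: k mult_ac)
  qed
  also have "\<dots> = (- 1) ^ n * (- (a + b) gchoose n)"
    using gbinomial_Vandermonde[of "- a" "- b" n]
    by (simp add: atLeast0AtMost flip: sum_distrib_left)
  finally show ?thesis
    by (simp only: k)
qed

lemma sum_cesaro_kernel: "(\<Sum>j\<le>n. cesaro_kernel a j) = cesaro_kernel (a + 1) n"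
  using cesaro_kernel_convolution[of a 1 n] by simp

lemma cesaro_kernel_2: "cesaro_kernel 2 n = real n + 1"
  using sum_cesaro_kernel[of 1 n] by simp

lemma cesaro_kernel_nonneg: "0 \<le> a \<Longrightarrow> 0 \<le> cesaro_kernel a n"
  by (induction n) (auto simp: cesaro_kernel_Suc)

lemma cesaro_kernel_antimono:
  assumes "0 \<le> a" "a \<le> 1"
  shows "antimono (cesaro_kernel a)"
proof (rule decseq_SucI)
  fix n
  have "cesaro_kernel a (Suc n) \<le> 1 * cesaro_kernel a n"
    unfolding cesaro_kernel_Suc
    using assms by (intro mult_right_mono cesaro_kernel_nonneg) auto
  then show "cesaro_kernel a (Suc n) \<le> cesaro_kernel a n" by simp
qed

lemma cesaro_kernel_minus_nonpos:
  assumes "0 \<le> s" "s \<le> 1"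
  shows "cesaro_kernel (- s) (Suc n) \<le> 0"
  using cesaro_kernel_lower_Suc[of "1 - s" n] assms
  by (auto intro!: divide_nonneg_nonneg mult_nonneg_nonneg cesaro_kernel_nonneg)

lemma summable_abs_cesaro_kernel_minus:
  assumes "0 \<le> s" "s \<le> 1"
  shows "summable (\<lambda>n. \<bar>cesaro_kernel (- s) n\<bar>)"
proof (rule bounded_imp_summable)
  fix n
  have "(\<Sum>k\<le>n. \<bar>cesaro_kernel (- s) k\<bar>) = 2 - (\<Sum>k\<le>n. cesaro_kernel (- s) k)"
    using cesaro_kernel_minus_nonpos[OF assms]
    by (induction n) (simp_all add: abs_of_nonpos)
  also have "\<dots> \<le> 2"
    using cesaro_kernel_nonneg[of "1 - s" n] assms by (simp add: sum_cesaro_kernel)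
  finally show "(\<Sum>k\<le>n. \<bar>cesaro_kernel (- s) k\<bar>) \<le> 2" .
qed simp

lemma decseq_cesaro_kernel_mult_powr:
  assumes "0 \<le> a" "a \<le> 1"
  shows "decseq (\<lambda>n. (real n + 1) powr (1 - a) * cesaro_kernel a n)"
proof (rule decseq_SucI)
  fix n
  define u where "u = real n + 1"
  have u: "u \<ge> 1" by (simp add: u_def)
  have "(1 + 1 / u) powr (1 - a) * (1 - (1 - a) / u) \<le> 1"
  proof -
    have "(1 + 1 / u) powr (1 - a) = (1 + 1 / u) powr (1 - a) * 1 powr a" by simp
    also have "\<dots> \<le> (1 - a) * (1 + 1 / u) + a * 1"
      using assms u by (intro Youngs_inequality_0) (auto intro: add_pos_pos)
    also have "\<dots> = 1 + (1 - a) / u" by (simp add: field_simps)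
    finally have "(1 + 1 / u) powr (1 - a) * (1 - (1 - a) / u) \<le> (1 + (1 - a) / u) * (1 - (1 - a) / u)"
      using assms u by (intro mult_right_mono) auto
    also have "\<dots> = 1 - ((1 - a) / u)\<^sup>2" by (simp add: power2_eq_square algebra_simps)
    finally show ?thesis by (smt (verit) zero_le_power2)
  qed
  then have "(u powr (1 - a) * (1 + 1 / u) powr (1 - a)) * (1 - (1 - a) / u) * cesaro_kernel a n
      \<le> u powr (1 - a) * cesaro_kernel a n"
    using mult_left_mono[of "(1 + 1 / u) powr (1 - a) * (1 - (1 - a) / u)" 1
        "u powr (1 - a) * cesaro_kernel a n"] cesaro_kernel_nonneg[of a n] assms
    by (simp add: mult_ac)
  moreover have "u powr (1 - a) * (1 + 1 / u) powr (1 - a) = (u + 1) powr (1 - a)"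
    using u by (simp add: distrib_left flip: powr_mult)
  moreover have "(1 - (1 - a) / u) * cesaro_kernel a n = cesaro_kernel a (Suc n)"
    by (simp add: u_def cesaro_kernel_Suc field_simps)
  ultimately show "(real (Suc n) + 1) powr (1 - a) * cesaro_kernel a (Suc n)
      \<le> (real n + 1) powr (1 - a) * cesaro_kernel a n"
    by (metis mult.assoc of_nat_Suc add.commute u_def)
qed

lemma incseq_cesaro_kernel_mult_powr:
  assumes "0 \<le> a" "a \<le> 1"
  shows "incseq (\<lambda>n. real n powr (1 - a) * cesaro_kernel a n)"
proof (rule incseq_SucI)
  fix n
  show "real n powr (1 - a) * cesaro_kernel a n
      \<le> real (Suc n) powr (1 - a) * cesaro_kernel a (Suc n)"
  proof (cases "n = 0")
    case False
    define u where "u = real n + 1"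
    have u: "u > 1" using False by (simp add: u_def)
    have "real n powr (1 - a) = real n powr (1 - a) * (u powr a * u powr (- a))"
      using u by (simp flip: powr_add)
    also have "\<dots> = (real n powr (1 - a) * u powr a) * u powr (- a)" by simp
    also have "\<dots> \<le> ((1 - a) * real n + a * u) * u powr (- a)"
      using assms u False by (intro mult_right_mono Youngs_inequality_0) auto
    also have "\<dots> = (a + real n) / u * u powr (1 - a)"
    proof -
      have "u powr (1 - a) = u * u powr (- a)"
        using u powr_add[of u 1 "- a"] by simp
      moreover have "(1 - a) * real n + a * u = a + real n" by (simp add: u_def algebra_simps)
      ultimately show ?thesis using u by simp
    qed
    finally have "real n powr (1 - a) * cesaro_kernel a n
      \<le> (a + real n) / u * u powr (1 - a) * cesaro_kernel a n"
      using assms by (intro mult_right_mono cesaro_kernel_nonneg) auto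
    then show ?thesis by (simp add: cesaro_kernel_Suc u_def mult_ac add_ac)
  qed (use assms in \<open>auto simp: cesaro_kernel_nonneg\<close>)
qed

lemma cesaro_kernel_le_powr:
  assumes "0 \<le> a" "a \<le> 1"
  shows "cesaro_kernel a n \<le> (real n + 1) powr (a - 1)"
proof -
  have "(real n + 1) powr (1 - a) * cesaro_kernel a n \<le> 1"
    using decseqD[OF decseq_cesaro_kernel_mult_powr[OF assms], of 0 n] by simp
  moreover have "(real n + 1) powr (a - 1) * (real n + 1) powr (1 - a) = 1"
    by (simp flip: powr_add)
  ultimately show ?thesis
    using mult_left_mono[of "(real n + 1) powr (1 - a) * cesaro_kernel a n" 1 "(real n + 1) powr (a - 1)"]
    by (simp flip: mult.assoc)
qed

lemma cesaro_kernel_plus_1_le_powr: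
  assumes "0 < a" "a \<le> 1"
  shows "a * cesaro_kernel (a + 1) n \<le> (real n + 1) powr a"
proof -
  have "a * cesaro_kernel (a + 1) n \<le> (real n + 1) * (real n + 1) powr (a - 1)"
    unfolding cesaro_kernel_raise
    using assms by (intro mult_mono cesaro_kernel_le_powr cesaro_kernel_nonneg) auto
  also have "\<dots> = (real n + 1) powr a"
    by (simp add: powr_diff)
  finally show ?thesis .
qed

lemma cesaro_kernel_plus_1_bound:
  assumes "0 \<le> a" "a \<le> 1"
  obtains C where "C > 0" "\<And>n. cesaro_kernel (a + 1) n \<le> C * (real n + 1) powr a"
proof (cases "a = 0")
  case True
  then show ?thesis using that[of 1] by simp
next
  case False
  then show ?thesis
    using assms cesaro_kernel_plus_1_le_powr[of a] that[of "1 / a"] by (simp add: field_simps)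
qed

lemma cesaro_kernel_asymp:
  assumes "0 < s" "s < 1"
  obtains L where "L > 0"
    "\<And>n. L * (real n + 1) powr (s - 1) \<le> cesaro_kernel s n"
    "\<And>n. n \<ge> 1 \<Longrightarrow> cesaro_kernel s n \<le> L * real n powr (s - 1)"
proof -
  define u where "u n = (real n + 1) powr (1 - s) * cesaro_kernel s n" for n
  define v where "v n = real n powr (1 - s) * cesaro_kernel s n" for n
  have "decseq u" unfolding u_def using assms by (intro decseq_cesaro_kernel_mult_powr) auto
  moreover have "0 \<le> u n" for n using assms by (simp add: u_def cesaro_kernel_nonneg)
  ultimately obtain L where L: "u \<longlonglongrightarrow> L" "\<And>n. L \<le> u n"
    using decseq_convergent by metis
  have "(\<lambda>n. (real n / (real n + 1)) powr (1 - s)) \<longlonglongrightarrow> 1 powr (1 - s)"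
    by (intro tendsto_intros LIMSEQ_n_over_Suc_n[unfolded of_nat_Suc add.commute[of 1]]) auto
  then have "(\<lambda>n. u n * (real n / (real n + 1)) powr (1 - s)) \<longlonglongrightarrow> L * 1 powr (1 - s)"
    by (intro tendsto_mult L)
  moreover have "u n * (real n / (real n + 1)) powr (1 - s) = v n" for n
    by (simp add: u_def v_def powr_divide)
  ultimately have v: "v \<longlonglongrightarrow> L" by simp
  have "incseq v" unfolding v_def using assms by (intro incseq_cesaro_kernel_mult_powr) auto
  then have vL: "v n \<le> L" for n by (rule incseq_le[OF _ v])
  show ?thesis
  proof
    show "L > 0" using vL[of 1] assms by (simp add: v_def cesaro_kernel_def)
  next
    fix n
    have "L * (real n + 1) powr (s - 1) \<le> u n * (real n + 1) powr (s - 1)"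
      using L by (intro mult_right_mono) auto
    also have "\<dots> = cesaro_kernel s n * ((real n + 1) powr (1 - s) * (real n + 1) powr (s - 1))"
      by (simp add: u_def)
    also have "\<dots> = cesaro_kernel s n" by (simp flip: powr_add)
    finally show "L * (real n + 1) powr (s - 1) \<le> cesaro_kernel s n" .
  next
    fix n :: nat assume "n \<ge> 1"
    then have "cesaro_kernel s n = cesaro_kernel s n * (real n powr (1 - s) * real n powr (s - 1))"
      by (simp flip: powr_add)
    also have "\<dots> = v n * real n powr (s - 1)" by (simp add: v_def)
    also have "\<dots> \<le> L * real n powr (s - 1)" using vL by (intro mult_right_mono) auto
    finally show "cesaro_kernel s n \<le> L * real n powr (s - 1)" .
  qed
qed

text \<open>Gosper summation of the partial Cauchy products of \<open>(1 - z)\<^sup>-\<^sup>s\<close> and \<open>(1 - z)\<^sup>s\<close>.\<close>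

lemma sum_cesaro_kernel_inverse:
  assumes "N < m"
  shows "(\<Sum>n\<le>N. cesaro_kernel s n * cesaro_kernel (- s) (m - n))
       = - (s * cesaro_kernel (s + 1) N * cesaro_kernel (1 - s) (m - Suc N) / real m)"
  using assms
proof (induction N)
  case 0
  then obtain i where "m = Suc i"
    using gr0_implies_Suc by blast
  then show ?case
    using cesaro_kernel_lower_Suc[of "1 - s" i] by (simp add: add.commute)
next
  case (Suc N)
  obtain i where m: "m = Suc (Suc N) + i"
    using Suc.prems less_iff_Suc_add[of "Suc N" m] by auto
  have d: "m - Suc N = Suc i" "m - Suc (Suc N) = i" by (simp_all add: m)
  have mi: "real m = real N + 2 + real i" by (simp add: m)
  have IH: "(\<Sum>n\<le>N. cesaro_kernel s n * cesaro_kernel (- s) (m - n))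
       = - (s * cesaro_kernel (s + 1) N * cesaro_kernel (1 - s) (Suc i) / real m)"
    using Suc by (simp add: d)
  have 1: "cesaro_kernel (- s) (Suc i) = - s / (real i + 1) * cesaro_kernel (1 - s) i"
    using cesaro_kernel_lower_Suc[of "1 - s" i] by simp
  have 2: "cesaro_kernel s (Suc N) = s / (real N + 1) * cesaro_kernel (s + 1) N"
    using cesaro_kernel_lower_Suc[of "s + 1" N] by simp
  have "(\<Sum>n\<le>Suc N. cesaro_kernel s n * cesaro_kernel (- s) (m - n))
      = s * cesaro_kernel (s + 1) N * cesaro_kernel (1 - s) i
        * (- ((1 - s + real i) / (real i + 1) / real m) - s / ((real N + 1) * (real i + 1)))"
    using Suc.prems
    by (simp add: IH d 1 2 cesaro_kernel_Suc[of "1 - s" i] algebra_simps)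
  also have "- ((1 - s + real i) / (real i + 1) / real m) - s / ((real N + 1) * (real i + 1))
      = - ((s + 1 + real N) / (real N + 1) / real m)"
  proof -
    have "real m > 0" "real i + 1 > 0" "real N + 1 > 0" by (simp_all add: m)
    then show ?thesis
      by (simp add: divide_simps) (simp add: mi algebra_simps)
  qed
  finally show ?case
    by (simp add: d cesaro_kernel_Suc[of "s + 1" N])
qed

section \<open>Power sums\<close>

lemma powr_Suc_diff_mvt:
  fixes x q :: real
  assumes "0 < x"
  obtains z where "x < z" "z < x + 1" "(x + 1) powr q - x powr q = q * z powr (q - 1)"
proof -
  have "\<exists>z. x < z \<and> z < x + 1 \<and> (x + 1) powr q - x powr q = (x + 1 - x) * (q * z powr (q - 1))"
    using assms by (intro MVT2 has_real_derivative_powr) auto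
  then show ?thesis using that by auto
qed

lemma sum_powr_minus_le:
  fixes p :: real
  assumes "0 \<le> p" "p < 1"
  shows "(1 - p) * (\<Sum>i<n. (real i + 1) powr (- p)) \<le> real n powr (1 - p)"
proof (induction n)
  case (Suc n)
  have "(1 - p) * (real n + 1) powr (- p) \<le> (real n + 1) powr (1 - p) - real n powr (1 - p)"
  proof (cases "n = 0")
    case False
    then obtain z where z: "real n < z" "z < real n + 1"
      "(real n + 1) powr (1 - p) - real n powr (1 - p) = (1 - p) * z powr (- p)"
      using powr_Suc_diff_mvt[of "real n" "1 - p"] by auto
    have "(real n + 1) powr (- p) \<le> z powr (- p)"
      using z assms False by (intro powr_mono2') auto
    then show ?thesis using assms z by (auto intro: mult_left_mono)
  qed (use assms in auto)
  then show ?case using Suc by (simp add: distrib_left add.commute)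
qed simp

lemma powr_minus_Suc_le_diff:
  fixes x s :: real
  assumes "0 < x" "0 < s"
  shows "s * (x + 1) powr (- s - 1) \<le> x powr (- s) - (x + 1) powr (- s)"
proof -
  obtain z where z: "x < z" "z < x + 1"
    "(x + 1) powr (- s) - x powr (- s) = - s * z powr (- s - 1)"
    using powr_Suc_diff_mvt[OF assms(1), of "- s"] by auto
  have "(x + 1) powr (- s - 1) \<le> z powr (- s - 1)"
    using z assms by (intro powr_mono2') auto
  then have "s * (x + 1) powr (- s - 1) \<le> s * z powr (- s - 1)"
    using assms by (intro mult_left_mono) auto
  then show ?thesis using z by simp
qed

lemma sum_powr_tail_le:
  fixes M s :: real
  assumes "0 < M" "0 < s"
  shows "s * (\<Sum>i<n. (M + 1 + real i) powr (- s - 1)) \<le> M powr (- s)"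
proof -
  have "s * (\<Sum>i<n. (M + 1 + real i) powr (- s - 1)) \<le> M powr (- s) - (M + real n) powr (- s)"
  proof (induction n)
    case (Suc n)
    then show ?case
      using powr_minus_Suc_le_diff[of "M + real n" s] assms
      by (simp add: distrib_left add_ac)
  qed simp
  also have "\<dots> \<le> M powr (- s)" by simp
  finally show ?thesis .
qed

text \<open>A discrete form of \<open>\<integral>\<^sub>0\<^sup>\<infinity> u\<^sup>-\<^sup>s\<^sup>-\<^sup>\<alpha> (M + u)\<^sup>\<alpha>\<^sup>-\<^sup>1 du = B(1 - s - \<alpha>, s) M\<^sup>-\<^sup>s\<close>.\<close>

lemma sum_beta_le:
  fixes s \<alpha> :: real
  assumes "0 < s" "0 \<le> \<alpha>" "\<alpha> < 1 - s"
  shows "(\<Sum>i<n. (real i + 1) powr (- s - \<alpha>) * (real N + 1 + real i) powr (\<alpha> - 1))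
       \<le> (1 / (1 - s - \<alpha>) + 1 / s) * (real N + 1) powr (- s)"
proof -
  define M where "M = real N + 1"
  define t where "t i = (real i + 1) powr (- s - \<alpha>) * (M + real i) powr (\<alpha> - 1)" for i :: nat
  have M: "M > 0" by (simp add: M_def)
  have split: "(\<Sum>i<m + k. t i) = (\<Sum>i<m. t i) + (\<Sum>i<k. t (m + i))" for m k
    by (induction k) simp_all
  have "(\<Sum>i<n. t i) \<le> (\<Sum>i<Suc N + n. t i)"
    by (intro sum_mono2) (auto simp: t_def)
  also have "\<dots> = (\<Sum>i<Suc N. t i) + (\<Sum>i<n. t (Suc N + i))" by (rule split)
  also have "(\<Sum>i<Suc N. t i) \<le> (\<Sum>i<Suc N. M powr (\<alpha> - 1) * (real i + 1) powr (- (s + \<alpha>)))"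
    unfolding t_def using M assms
    by (intro sum_mono) (auto simp: mult.commute intro!: mult_mono powr_mono2')
  also have "\<dots> = M powr (\<alpha> - 1) * (\<Sum>i<Suc N. (real i + 1) powr (- (s + \<alpha>)))"
    by (simp only: sum_distrib_left)
  also have "\<dots> \<le> M powr (\<alpha> - 1) * (M powr (1 - (s + \<alpha>)) / (1 - s - \<alpha>))"
    using sum_powr_minus_le[of "s + \<alpha>" "Suc N"] assms
    by (intro mult_left_mono) (auto simp: M_def field_simps)
  also have "\<dots> = 1 / (1 - s - \<alpha>) * M powr (- s)"
    using M by (simp flip: powr_add)
  also have "(\<Sum>i<n. t (Suc N + i)) \<le> (\<Sum>i<n. (M + 1 + real i) powr (- s - 1))"
  proof (intro sum_mono)
    fix i
    have "t (Suc N + i) = (M + 1 + real i) powr (- s - \<alpha>) * (M + M + real i) powr (\<alpha> - 1)"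
      by (simp add: t_def M_def add_ac)
    also have "\<dots> \<le> (M + 1 + real i) powr (- s - \<alpha>) * (M + 1 + real i) powr (\<alpha> - 1)"
      using assms by (intro mult_left_mono powr_mono2') (auto simp: M_def)
    also have "\<dots> = (M + 1 + real i) powr (- s - 1)"
      by (simp flip: powr_add)
    finally show "t (Suc N + i) \<le> (M + 1 + real i) powr (- s - 1)" .
  qed
  also have "\<dots> \<le> 1 / s * M powr (- s)"
    using sum_powr_tail_le[OF M assms(1), of n] assms by (simp add: field_simps)
  finally show ?thesis
    by (simp add: t_def M_def distrib_right)
qed

section \<open>Functionals separating points\<close>

definition sublinear_functional :: "('a::real_vector \<Rightarrow> real) \<Rightarrow> bool" where
  "sublinear_functional p \<longleftrightarrow>
     (\<forall>x y. p (x + y) \<le> p x + p y) \<and> (\<forall>t x. 0 \<le> t \<longrightarrow> p (t *\<^sub>R x) = t * p x)"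

lemma sublinear_functional_add: "sublinear_functional p \<Longrightarrow> p (x + y) \<le> p x + p y"
  and sublinear_functional_scale: "sublinear_functional p \<Longrightarrow> 0 \<le> t \<Longrightarrow> p (t *\<^sub>R x) = t * p x"
  by (auto simp: sublinear_functional_def)

lemma sublinear_functional_zero: "sublinear_functional p \<Longrightarrow> p 0 = 0"
  using sublinear_functional_scale[of p 0 0] by simp

lemma sublinear_functional_minus: "sublinear_functional p \<Longrightarrow> - p (- x) \<le> p x"
  using sublinear_functional_add[of p x "- x"] sublinear_functional_zero[of p] by simp

lemma sublinear_functionalI:
  assumes add: "\<And>x y. p (x + y) \<le> p x + p y" and "p 0 = 0"
    and scale: "\<And>t x. 0 < t \<Longrightarrow> p (t *\<^sub>R x) \<le> t * p x"
  shows "sublinear_functional p"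
  unfolding sublinear_functional_def
proof (intro conjI allI impI)
  fix t :: real and x assume "0 \<le> t"
  show "p (t *\<^sub>R x) = t * p x"
  proof (cases "t = 0")
    case False
    then have "t > 0" using \<open>0 \<le> t\<close> by simp
    moreover have "p x \<le> inverse t * p (t *\<^sub>R x)"
      using scale[of "inverse t" "t *\<^sub>R x"] \<open>t > 0\<close> by simp
    ultimately show ?thesis
      using scale[of t x] by (simp add: field_simps)
  qed (use \<open>p 0 = 0\<close> in auto)
qed (rule add)

definition tilt :: "('a::real_vector \<Rightarrow> real) \<Rightarrow> 'a \<Rightarrow> 'a \<Rightarrow> real" where
  "tilt p y x = (INF t\<in>{0..}. p (x + t *\<^sub>R y) - t * p y)"

lemma tilt_le:
  assumes "sublinear_functional p" "0 \<le> t"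
  shows "tilt p y x \<le> p (x + t *\<^sub>R y) - t * p y"
  unfolding tilt_def
proof (rule cINF_lower)
  show "bdd_below ((\<lambda>t. p (x + t *\<^sub>R y) - t * p y) ` {0..})"
  proof (rule bdd_belowI2)
    fix t :: real assume "t \<in> {0..}"
    then show "- p (- x) \<le> p (x + t *\<^sub>R y) - t * p y"
      using sublinear_functional_add[OF assms(1), of "x + t *\<^sub>R y" "- x"]
        sublinear_functional_scale[OF assms(1), of t y] by simp
  qed
qed (use assms in auto)

lemma tilt_greatest: "(\<And>t. 0 \<le> t \<Longrightarrow> m \<le> p (x + t *\<^sub>R y) - t * p y) \<Longrightarrow> m \<le> tilt p y x"
  unfolding tilt_def by (rule cINF_greatest) auto

lemma sublinear_functional_tilt:
  assumes p: "sublinear_functional p"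
  shows "sublinear_functional (tilt p y)"
proof (rule sublinear_functionalI)
  fix x z
  have "tilt p y (x + z) - (p (z + u *\<^sub>R y) - u * p y) \<le> tilt p y x" if u: "0 \<le> u" for u
  proof (rule tilt_greatest)
    fix t :: real assume t: "0 \<le> t"
    have "tilt p y (x + z) \<le> p ((x + t *\<^sub>R y) + (z + u *\<^sub>R y)) - (t + u) * p y"
      using tilt_le[OF p, of "t + u" y "x + z"] t u by (simp add: algebra_simps)
    also have "\<dots> \<le> p (x + t *\<^sub>R y) + p (z + u *\<^sub>R y) - (t + u) * p y"
      using sublinear_functional_add[OF p] by simp
    finally show "tilt p y (x + z) - (p (z + u *\<^sub>R y) - u * p y) \<le> p (x + t *\<^sub>R y) - t * p y"
      by (simp add: algebra_simps)
  qed
  then have "tilt p y (x + z) - tilt p y x \<le> tilt p y z"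
    by (intro tilt_greatest) (simp add: algebra_simps)
  then show "tilt p y (x + z) \<le> tilt p y x + tilt p y z" by simp
next
  show "tilt p y 0 = 0"
  proof (rule antisym)
    show "tilt p y 0 \<le> 0"
      using tilt_le[OF p, of 0 y 0] sublinear_functional_zero[OF p] by simp
    show "0 \<le> tilt p y 0"
      by (rule tilt_greatest) (simp add: sublinear_functional_scale[OF p])
  qed
next
  fix t :: real and x assume t: "0 < t"
  have "tilt p y (t *\<^sub>R x) / t \<le> tilt p y x"
  proof (rule tilt_greatest)
    fix u :: real assume u: "0 \<le> u"
    have "tilt p y (t *\<^sub>R x) \<le> p (t *\<^sub>R x + (t * u) *\<^sub>R y) - t * u * p y"
      using t u by (intro tilt_le p) auto
    also have "t *\<^sub>R x + (t * u) *\<^sub>R y = t *\<^sub>R (x + u *\<^sub>R y)"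
      by (simp add: scaleR_add_right)
    also have "p \<dots> = t * p (x + u *\<^sub>R y)"
      using t by (intro sublinear_functional_scale p) auto
    finally show "tilt p y (t *\<^sub>R x) / t \<le> p (x + u *\<^sub>R y) - u * p y"
      using t by (simp add: field_simps)
  qed
  then show "tilt p y (t *\<^sub>R x) \<le> t * tilt p y x"
    using t by (simp add: field_simps)
qed

lemma sublinear_functional_chain_Inf:
  fixes C :: "('a::real_vector \<Rightarrow> real) set"
  assumes "C \<noteq> {}" and sub: "\<And>p. p \<in> C \<Longrightarrow> sublinear_functional p"
    and bound: "\<And>p. p \<in> C \<Longrightarrow> p \<le> p0"
    and chain: "\<And>p q. p \<in> C \<Longrightarrow> q \<in> C \<Longrightarrow> p \<le> q \<or> q \<le> p"
  shows "sublinear_functional (\<lambda>x. INF p\<in>C. p x)"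
    and "\<And>p x. p \<in> C \<Longrightarrow> (INF p\<in>C. p x) \<le> p x"
proof -
  show lower: "(INF p\<in>C. p x) \<le> p x" if "p \<in> C" for p x
  proof (rule cINF_lower[OF _ that])
    show "bdd_below ((\<lambda>p. p x) ` C)"
    proof (rule bdd_belowI2)
      fix p assume "p \<in> C"
      then show "- p0 (- x) \<le> p x"
        using sublinear_functional_minus[OF sub, of p x] bound[of p] by (simp add: le_fun_def) (smt (verit))
    qed
  qed
  show "sublinear_functional (\<lambda>x. INF p\<in>C. p x)"
  proof (rule sublinear_functionalI)
    fix x y
    have "(INF p\<in>C. p (x + y)) - p x \<le> (INF q\<in>C. q y)" if p: "p \<in> C" for p
    proof (rule cINF_greatest)
      fix q assume q: "q \<in> C"
      obtain r where r: "r \<in> C" "r x \<le> p x" "r y \<le> q y"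
        using chain[OF p q] p q by (auto simp: le_fun_def)
      have "(INF p\<in>C. p (x + y)) \<le> r x + r y"
        using lower[OF r(1), of "x + y"] sublinear_functional_add[OF sub[OF r(1)], of x y] by simp
      then show "(INF p\<in>C. p (x + y)) - p x \<le> q y" using r by simp
    qed fact
    then have "(INF p\<in>C. p (x + y)) - (INF q\<in>C. q y) \<le> (INF p\<in>C. p x)"
      by (intro cINF_greatest \<open>C \<noteq> {}\<close>) (simp add: algebra_simps)
    then show "(INF p\<in>C. p (x + y)) \<le> (INF p\<in>C. p x) + (INF q\<in>C. q y)" by simp
  next
    have "(\<lambda>p. p 0) ` C = {0}"
      using \<open>C \<noteq> {}\<close> sublinear_functional_zero[OF sub] by (auto simp: image_iff)
    then show "(INF p\<in>C. p 0) = 0" by simp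
  next
    fix t :: real and x assume t: "0 < t"
    have "(INF p\<in>C. p (t *\<^sub>R x)) / t \<le> (INF p\<in>C. p x)"
    proof (rule cINF_greatest)
      fix p assume p: "p \<in> C"
      show "(INF p\<in>C. p (t *\<^sub>R x)) / t \<le> p x"
        using lower[OF p, of "t *\<^sub>R x"] t sublinear_functional_scale[OF sub[OF p], of t x]
        by (simp add: field_simps)
    qed fact
    then show "(INF p\<in>C. p (t *\<^sub>R x)) \<le> t * (INF p\<in>C. p x)"
      using t by (simp add: field_simps)
  qed
qed

text \<open>A minimal sublinear functional \<open>m\<close> is linear: \<open>tilt m y\<close> cannot be smaller than \<open>m\<close>, which is
  superadditivity of \<open>m\<close>.\<close>

theorem hahn_banach_sublinear:
  fixes p :: "'a::real_vector \<Rightarrow> real"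
  assumes p: "sublinear_functional p"
  obtains f where "linear f" "\<And>x. f x \<le> p x"
proof -
  define A where "A = {q. sublinear_functional q \<and> (\<forall>x. q x \<le> p x)}"
  define R where "R = (\<lambda>q r :: 'a \<Rightarrow> real. \<forall>x. r x \<le> q x)"
  have "\<exists>m\<in>A. \<forall>q\<in>A. R m q \<longrightarrow> q = m"
  proof (rule predicate_Zorn)
    show "partial_order_on A (relation_of R A)"
      by (rule partial_order_on_relation_ofI)
         (auto simp: R_def intro!: ext antisym intro: order_trans)
  next
    fix C assume "C \<in> Chains (relation_of R A)"
    then have CA: "C \<subseteq> A" and ch: "\<And>q r. q \<in> C \<Longrightarrow> r \<in> C \<Longrightarrow> R q r \<or> R r q"
      by (auto simp: Chains_def relation_of_def)
    show "\<exists>u\<in>A. \<forall>a\<in>C. R a u"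
    proof (cases "C = {}")
      case True
      then show ?thesis using p by (auto simp: A_def)
    next
      case False
      have sub: "\<And>q. q \<in> C \<Longrightarrow> sublinear_functional q" and le: "\<And>q. q \<in> C \<Longrightarrow> q \<le> p"
        using CA by (auto simp: A_def le_fun_def)
      have chain: "\<And>q r. q \<in> C \<Longrightarrow> r \<in> C \<Longrightarrow> q \<le> r \<or> r \<le> q"
        using ch unfolding R_def le_fun_def by blast
      note inf = sublinear_functional_chain_Inf[OF False sub le chain]
      have "(INF q\<in>C. q x) \<le> p x" for x
        using False inf(2) le unfolding le_fun_def by (meson ex_in_conv order_trans)
      then have "(\<lambda>x. INF q\<in>C. q x) \<in> A"
        using inf(1) by (simp add: A_def)
      moreover have "\<forall>q\<in>C. R q (\<lambda>x. INF q\<in>C. q x)"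
        using inf(2) by (simp add: R_def)
      ultimately show ?thesis by blast
    qed
  qed
  then obtain m where m: "sublinear_functional m" "\<And>x. m x \<le> p x"
    and min: "\<And>q. q \<in> A \<Longrightarrow> (\<And>x. q x \<le> m x) \<Longrightarrow> q = m"
    by (auto simp: A_def R_def)
  have tilt: "tilt m y = m" for y
  proof -
    have le: "tilt m y x \<le> m x" for x using tilt_le[OF m(1), of 0 y x] by simp
    then have "tilt m y \<in> A"
      using sublinear_functional_tilt[OF m(1)] m(2) by (auto simp: A_def intro: order_trans)
    then show ?thesis using min le by blast
  qed
  have add: "m (x + y) = m x + m y" for x y
    using tilt_le[OF m(1), of 1 y x] sublinear_functional_add[OF m(1), of x y]
    by (simp add: tilt)
  have neg: "m (- x) = - m x" for x
    using add[of x "- x"] sublinear_functional_zero[OF m(1)] by simp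
  have "linear m"
  proof (rule linearI)
    fix t x
    show "m (t *\<^sub>R x) = t *\<^sub>R m x"
    proof (cases "0 \<le> t")
      case False
      then show ?thesis
        using sublinear_functional_scale[OF m(1), of "- t" x] neg[of "t *\<^sub>R x"] by simp
    qed (simp add: sublinear_functional_scale[OF m(1)])
  qed (rule add)
  then show ?thesis using m(2) that by blast
qed

lemma exists_real_functional_nonzero:
  fixes v :: "'a::real_normed_vector"
  assumes "v \<noteq> 0"
  obtains f where "linear f" "\<And>x. \<bar>f x\<bar> \<le> norm x" "f v \<noteq> 0"
proof -
  have norm: "sublinear_functional (norm :: 'a \<Rightarrow> real)"
    by (simp add: sublinear_functional_def norm_triangle_ineq)
  obtain f where f: "linear f" "\<And>x. f x \<le> tilt norm v x"
    using hahn_banach_sublinear[OF sublinear_functional_tilt[OF norm]] by blast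
  have le: "f x \<le> norm x" for x
    using f(2)[of x] tilt_le[OF norm, of 0 v x] by simp
  have "f (- v) \<le> - norm v"
    using f(2)[of "- v"] tilt_le[OF norm, of 1 v "- v"] by simp
  then have "f v \<noteq> 0"
    using assms by (auto simp: linear_neg[OF f(1)])
  moreover have "\<bar>f x\<bar> \<le> norm x" for x
    using le[of x] le[of "- x"] by (simp add: linear_neg[OF f(1)] abs_le_iff)
  ultimately show ?thesis using that f(1) by blast
qed

lemma linear_scaleC: "linear (\<lambda>x. c *\<^sub>C x :: 'a::complex_normed_vector)"
  by (rule linearI) (simp_all add: scaleC_add_right scaleR_scaleC scaleC_scaleC mult.commute)

lemma exists_complex_functional_nonzero:
  fixes v :: "'a::complex_normed_vector"
  assumes "v \<noteq> 0"
  obtains \<phi> :: "'a \<Rightarrow>\<^sub>L complex" where "complex_linear \<phi>" "\<phi> v \<noteq> 0"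
proof -
  obtain f where f: "linear f" "\<And>x :: 'a. \<bar>f x\<bar> \<le> norm x" "f v \<noteq> 0"
    using exists_real_functional_nonzero[OF assms] by blast
  define g where "g x = Complex (f x) (- f (\<i> *\<^sub>C x))" for x
  have gc: "g (c *\<^sub>C x) = c * g x" for c x
  proof -
    have c: "c *\<^sub>C y = Re c *\<^sub>R y + Im c *\<^sub>R (\<i> *\<^sub>C y)" for y
      using complex_eq[of c]
      by (simp add: scaleR_scaleC scaleC_scaleC mult.commute flip: scaleC_add_left)
    have i: "\<i> *\<^sub>C \<i> *\<^sub>C x = - x"
      using scaleR_scaleC[of "- 1" x] by (simp add: scaleC_scaleC)
    have "\<i> *\<^sub>C c *\<^sub>C x = c *\<^sub>C \<i> *\<^sub>C x" by (simp add: scaleC_scaleC mult.commute)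
    also have "\<dots> = Re c *\<^sub>R (\<i> *\<^sub>C x) - Im c *\<^sub>R x" by (subst c) (simp add: i)
    finally have "f (\<i> *\<^sub>C c *\<^sub>C x) = Re c * f (\<i> *\<^sub>C x) - Im c * f x"
      by (simp add: linear_diff[OF f(1)] linear_scale[OF f(1)])
    moreover have "f (c *\<^sub>C x) = Re c * f x + Im c * f (\<i> *\<^sub>C x)"
      by (subst c) (simp add: linear_add[OF f(1)] linear_scale[OF f(1)])
    ultimately show ?thesis by (simp add: g_def complex_eq_iff)
  qed
  have "bounded_linear g"
  proof (rule bounded_linear_intro)
    fix x y
    show "g (x + y) = g x + g y"
      by (simp add: g_def linear_add[OF f(1)] scaleC_add_right complex_eq_iff)
  next
    fix r x
    show "g (r *\<^sub>R x) = r *\<^sub>R g x"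
      by (simp add: gc scaleR_scaleC[of r x] scaleR_conv_of_real)
  next
    fix x
    have "norm (g x) \<le> \<bar>f x\<bar> + \<bar>f (\<i> *\<^sub>C x)\<bar>"
      using cmod_le[of "g x"] by (simp add: g_def)
    also have "\<dots> \<le> norm x * 2"
      using f(2)[of x] f(2)[of "\<i> *\<^sub>C x"] by (simp add: norm_scaleC)
    finally show "norm (g x) \<le> norm x * 2" .
  qed
  then have g: "blinfun_apply (Blinfun g) = g" by (rule bounded_linear_Blinfun_apply)
  show ?thesis
  proof
    show "complex_linear (Blinfun g)"
      by (simp add: complex_linear_def g gc scaleC_complex_def)
    show "Blinfun g v \<noteq> 0" using f(3) by (simp add: g g_def complex_eq_iff)
  qed
qed

section \<open>Growth of Cesaro bounded operators\<close>

lemma sum_triangle_swap: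
  fixes a :: "nat \<Rightarrow> nat \<Rightarrow> 'a::comm_monoid_add"
  shows "(\<Sum>i\<le>n. \<Sum>j\<le>i. a i j) = (\<Sum>j\<le>n. \<Sum>i\<le>n - j. a (j + i) j)"
proof (induction n)
  case (Suc n)
  have "(\<Sum>j\<le>n. \<Sum>i\<le>Suc n - j. a (j + i) j)
      = (\<Sum>j\<le>n. (\<Sum>i\<le>n - j. a (j + i) j) + a (Suc n) j)"
    by (intro sum.cong refl) (simp add: Suc_diff_le)
  then show ?case using Suc by (simp add: sum.distrib add.assoc)
qed simp

lemma sum_atMost_add_Suc:
  fixes f :: "nat \<Rightarrow> 'a::comm_monoid_add"
  shows "(\<Sum>i\<le>m + Suc n. f i) = (\<Sum>i\<le>m. f i) + (\<Sum>i\<le>n. f (Suc m + i))"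
  by (induction n) (simp_all add: add.assoc)

lemma blinfun_pow_add: "blinfun_pow T (m + n) = blinfun_pow T m o\<^sub>L blinfun_pow T n"
  by (induction m) (auto intro!: blinfun_eqI)

lemma cesaro_sum_atMost:
  "cesaro_sum a T n = (\<Sum>j\<le>n. cesaro_kernel a (n - j) *\<^sub>R blinfun_pow T j)"
  by (simp add: cesaro_sum_def atLeast0AtMost)

lemma cesaro_sum_1: "cesaro_sum 1 T n = (\<Sum>j\<le>n. blinfun_pow T j)"
  by (simp add: cesaro_sum_atMost)

lemma cesaro_sum_add:
  "cesaro_sum (a + b) T n = (\<Sum>j\<le>n. cesaro_kernel a (n - j) *\<^sub>R cesaro_sum b T j)"
proof -
  have "(\<Sum>j\<le>n. cesaro_kernel a (n - j) *\<^sub>R cesaro_sum b T j)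
      = (\<Sum>j\<le>n. \<Sum>l\<le>j. (cesaro_kernel a (n - j) * cesaro_kernel b (j - l)) *\<^sub>R blinfun_pow T l)"
    by (simp add: cesaro_sum_atMost scaleR_sum_right)
  also have "\<dots> = (\<Sum>l\<le>n. \<Sum>i\<le>n - l.
      (cesaro_kernel b i * cesaro_kernel a (n - l - i)) *\<^sub>R blinfun_pow T l)"
    by (subst sum_triangle_swap) (simp add: mult.commute)
  also have "\<dots> = cesaro_sum (a + b) T n"
    by (simp only: cesaro_sum_atMost cesaro_kernel_convolution add.commute[of b a]
        scaleR_sum_left[symmetric])
  finally show ?thesis ..
qed

lemma incseq_cesaro_kernel_plus_1: "0 \<le> a \<Longrightarrow> incseq (cesaro_kernel (a + 1))"
  using cesaro_kernel_diff[of "a + 1"] cesaro_kernel_nonneg[of a]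
  by (intro incseq_SucI) (simp, metis diff_ge_0_iff_ge)

lemma cesaro_boundedE:
  assumes "cesaro_bounded a T" "0 \<le> a"
  obtains C where "C \<ge> 0" "\<And>n. norm (cesaro_sum a T n) \<le> C * cesaro_kernel (a + 1) n"
proof -
  obtain C where C: "\<And>n. norm (cesaro_sum a T n) / cesaro_kernel (a + 1) n \<le> C"
    using assms unfolding cesaro_bounded_def bdd_above_def by auto
  have pos: "cesaro_kernel (a + 1) n \<ge> 1" for n
    using incseqD[OF incseq_cesaro_kernel_plus_1[OF assms(2)], of 0 n] by simp
  show ?thesis
  proof
    fix n
    show "norm (cesaro_sum a T n) \<le> max C 0 * cesaro_kernel (a + 1) n"
      using C[of n] pos[of n]
      by (smt (verit, ccfv_SIG) divide_le_eq max.cobounded1 mult_right_mono)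
  qed simp
qed

lemma norm_cesaro_sum_1_le:
  assumes "0 \<le> a" "a \<le> 1" and C: "\<And>n. norm (cesaro_sum a T n) \<le> C * cesaro_kernel (a + 1) n"
  shows "(\<Sum>j\<le>n. cesaro_kernel (1 - a) (n - j) * norm (cesaro_sum a T j)) \<le> C * (real n + 1)"
    and "norm (cesaro_sum 1 T n) \<le> C * (real n + 1)"
proof -
  have "(\<Sum>j\<le>n. cesaro_kernel (1 - a) (n - j) * norm (cesaro_sum a T j))
      \<le> (\<Sum>j\<le>n. cesaro_kernel (1 - a) (n - j) * (C * cesaro_kernel (a + 1) j))"
    using assms by (intro sum_mono mult_left_mono cesaro_kernel_nonneg) auto
  also have "\<dots> = C * (\<Sum>j\<le>n. cesaro_kernel (a + 1) j * cesaro_kernel (1 - a) (n - j))"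
    by (simp add: sum_distrib_left mult_ac)
  also have "\<dots> = C * (real n + 1)"
    unfolding cesaro_kernel_convolution by (simp add: cesaro_kernel_2)
  finally show le: "(\<Sum>j\<le>n. cesaro_kernel (1 - a) (n - j) * norm (cesaro_sum a T j)) \<le> C * (real n + 1)" .
  have "cesaro_sum 1 T n = (\<Sum>j\<le>n. cesaro_kernel (1 - a) (n - j) *\<^sub>R cesaro_sum a T j)"
    using cesaro_sum_add[of "1 - a" a T n] by simp
  also have "norm \<dots> \<le> (\<Sum>j\<le>n. cesaro_kernel (1 - a) (n - j) * norm (cesaro_sum a T j))"
    using assms by (intro order_trans[OF norm_sum]) (simp add: cesaro_kernel_nonneg)
  also note le
  finally show "norm (cesaro_sum 1 T n) \<le> C * (real n + 1)" .
qed

text \<open>The gain over the trivial bound comes from the monotonicity of \<open>cesaro_kernel (1 - a)\<close>: the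
  coefficients of the difference telescope.\<close>

lemma norm_cesaro_sum_1_diff_le:
  assumes a: "0 \<le> a" "a \<le> 1" and "C \<ge> 0"
    and C: "\<And>n. norm (cesaro_sum a T n) \<le> C * cesaro_kernel (a + 1) n"
  shows "norm (cesaro_sum 1 T (N + Suc i) - cesaro_sum 1 T N)
       \<le> 2 * C * cesaro_kernel (a + 1) (N + Suc i) * cesaro_kernel (2 - a) i"
proof -
  define K where "K = cesaro_kernel (1 - a)"
  define S where "S = cesaro_sum a T"
  define G where "G = C * cesaro_kernel (a + 1) (N + Suc i)"
  have K_nonneg: "0 \<le> K n" for n using a by (simp add: K_def cesaro_kernel_nonneg)
  have K_mono: "m \<le> n \<Longrightarrow> K n \<le> K m" for m n
    using antimonoD[OF cesaro_kernel_antimono[of "1 - a"], of m n] a by (simp add: K_def)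
  have sumK: "(\<Sum>j\<le>n. K (n - j)) = cesaro_kernel (2 - a) n" for n
    using cesaro_kernel_convolution[of 1 "1 - a" n] by (simp add: K_def)
  have SG: "norm (S n) \<le> G" if "n \<le> N + Suc i" for n
  proof -
    have "C * cesaro_kernel (a + 1) n \<le> G"
      unfolding G_def using incseqD[OF incseq_cesaro_kernel_plus_1[OF a(1)] that] \<open>C \<ge> 0\<close>
      by (intro mult_left_mono) auto
    then show ?thesis using C[of n] by (simp add: S_def)
  qed
  have U: "cesaro_sum 1 T n = (\<Sum>j\<le>n. K (n - j) *\<^sub>R S j)" for n
    using cesaro_sum_add[of "1 - a" a T n] by (simp add: K_def S_def)
  have "cesaro_sum 1 T (N + Suc i) - cesaro_sum 1 T N
      = (\<Sum>j\<le>i. K (i - j) *\<^sub>R S (Suc N + j))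
        - (\<Sum>j\<le>N. (K (N - j) - K (N + Suc i - j)) *\<^sub>R S j)"
    unfolding U sum_atMost_add_Suc
    by (simp add: scaleR_diff_left sum_subtractf)
  also have "norm \<dots> \<le> (\<Sum>j\<le>i. K (i - j) * G) + (\<Sum>j\<le>N. (K (N - j) - K (N + Suc i - j)) * G)"
  proof (intro order_trans[OF norm_triangle_ineq4] add_mono order_trans[OF norm_sum] sum_mono)
    fix j assume "j \<in> {..i}"
    then show "norm (K (i - j) *\<^sub>R S (Suc N + j)) \<le> K (i - j) * G"
      using SG[of "Suc N + j"] K_nonneg by (auto intro: mult_left_mono)
  next
    fix j assume "j \<in> {..N}"
    then show "norm ((K (N - j) - K (N + Suc i - j)) *\<^sub>R S j) \<le> (K (N - j) - K (N + Suc i - j)) * G"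
      using SG[of j] K_mono[of "N - j" "N + Suc i - j"] by (auto intro: mult_left_mono)
  qed
  also have "\<dots> = ((\<Sum>j\<le>i. K (i - j)) + (\<Sum>j\<le>N. K (N - j)) - (\<Sum>j\<le>N. K (N + Suc i - j))) * G"
    by (simp add: sum_subtractf distrib_right left_diff_distrib flip: sum_distrib_right)
  also have "(\<Sum>j\<le>N. K (N + Suc i - j)) = cesaro_kernel (2 - a) (N + Suc i) - (\<Sum>j\<le>i. K (i - j))"
    using sum_atMost_add_Suc[of "\<lambda>j. K (N + Suc i - j)" N i]
    by (simp add: sumK[symmetric] del: sum.atMost_Suc)
  finally have "norm (cesaro_sum 1 T (N + Suc i) - cesaro_sum 1 T N)
      \<le> (2 * cesaro_kernel (2 - a) i + cesaro_kernel (2 - a) N - cesaro_kernel (2 - a) (N + Suc i)) * G"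
    by (simp add: sumK add_diff_eq)
  also have "\<dots> \<le> (2 * cesaro_kernel (2 - a) i) * G"
  proof (rule mult_right_mono)
    show "2 * cesaro_kernel (2 - a) i + cesaro_kernel (2 - a) N - cesaro_kernel (2 - a) (N + Suc i)
        \<le> 2 * cesaro_kernel (2 - a) i"
      using incseqD[OF incseq_cesaro_kernel_plus_1[of "1 - a"], of N "N + Suc i"] a by simp
    show "0 \<le> G" using SG[of 0] norm_ge_zero order_trans by blast
  qed
  finally show ?thesis by (simp add: G_def mult_ac)
qed

lemma cesaro_bounded_growth:
  assumes "0 \<le> a" "a \<le> 1" "cesaro_bounded a T"
  obtains C where "C \<ge> 0"
    "\<And>N i. norm (\<Sum>l\<le>i. blinfun_pow T (Suc N + l))
        \<le> C * ((real N + 1 + real i) powr a * (real i + 1) powr (1 - a))"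
proof -
  obtain C where C: "C \<ge> 0" "\<And>n. norm (cesaro_sum a T n) \<le> C * cesaro_kernel (a + 1) n"
    using cesaro_boundedE assms by blast
  obtain D where D: "D > 0" "\<And>n. cesaro_kernel (a + 1) n \<le> D * (real n + 1) powr a"
    using cesaro_kernel_plus_1_bound[of a] assms by blast
  obtain E where E: "E > 0" "\<And>n. cesaro_kernel (2 - a) n \<le> E * (real n + 1) powr (1 - a)"
    using cesaro_kernel_plus_1_bound[of "1 - a"] assms by (auto simp: algebra_simps)
  show ?thesis
  proof
    show "2 * C * (D * 2) * E \<ge> 0" using C D E by simp
    fix N i
    have "(\<Sum>l\<le>i. blinfun_pow T (Suc N + l)) = cesaro_sum 1 T (N + Suc i) - cesaro_sum 1 T N"
      unfolding cesaro_sum_1 sum_atMost_add_Suc by simp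
    then have "norm (\<Sum>l\<le>i. blinfun_pow T (Suc N + l))
        \<le> 2 * C * cesaro_kernel (a + 1) (N + Suc i) * cesaro_kernel (2 - a) i"
      using norm_cesaro_sum_1_diff_le[OF assms(1,2) C] by simp
    also have "\<dots> \<le> 2 * C * (D * (2 * (real N + 1 + real i) powr a)) * (E * (real i + 1) powr (1 - a))"
    proof (intro mult_mono E)
      have "(real (N + Suc i) + 1) powr a \<le> (2 * (real N + 1 + real i)) powr a"
        using assms by (intro powr_mono2) auto
      also have "\<dots> = 2 powr a * (real N + 1 + real i) powr a" by (rule powr_mult)
      also have "\<dots> \<le> 2 * (real N + 1 + real i) powr a"
        using powr_mono[of a 1 2] assms by (intro mult_right_mono) auto
      finally have "D * (real (N + Suc i) + 1) powr a \<le> D * (2 * (real N + 1 + real i) powr a)"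
        using D by (intro mult_left_mono) auto
      then show "cesaro_kernel (a + 1) (N + Suc i) \<le> D * (2 * (real N + 1 + real i) powr a)"
        using D(2)[of "N + Suc i"] by linarith
    qed (use assms C D E in \<open>auto simp: cesaro_kernel_nonneg\<close>)
    finally show "norm (\<Sum>l\<le>i. blinfun_pow T (Suc N + l))
        \<le> 2 * C * (D * 2) * E * ((real N + 1 + real i) powr a * (real i + 1) powr (1 - a))"
      by (simp add: mult_ac)
  qed
qed

lemma frac_power_sums:
  fixes T :: "'a::banach \<Rightarrow>\<^sub>L 'a"
  assumes s: "0 < s" "s < 1" and a: "0 \<le> a" "a \<le> 1" and T: "cesaro_bounded a T"
  shows "(\<lambda>m. cesaro_kernel (- s) m *\<^sub>R blinfun_pow T m) sums frac_power a s T"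
proof -
  define f where "f = cesaro_kernel (- s)"
  define d where "d n = f n - f (Suc n)" for n
  define K where "K = cesaro_kernel (1 - a)"
  define S where "S = cesaro_sum a T"
  define U where "U = cesaro_sum 1 T"
  define w where "w = weyl_difference a f"
  obtain C where C: "C \<ge> 0" "\<And>n. norm (cesaro_sum a T n) \<le> C * cesaro_kernel (a + 1) n"
    using cesaro_boundedE a T by blast
  define g where "g n = C * (1 + s) * \<bar>f n\<bar>" for n
  have d: "d n = (1 + s) * f n / (real n + 1)" for n
    using cesaro_kernel_diff[of "- s" n] cesaro_kernel_lower_Suc[of "- s" n]
    by (simp add: d_def f_def divide_simps) (simp add: algebra_simps)
  have summ_f: "summable (\<lambda>n. \<bar>f n\<bar>)"
    using summable_abs_cesaro_kernel_minus[of s] s by (simp add: f_def)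
  then have summ_g: "summable g" unfolding g_def by (rule summable_mult)
  have f0: "f \<longlonglongrightarrow> 0"
    using summable_LIMSEQ_zero[OF summ_f] by (simp add: tendsto_rabs_zero_iff)
  have K: "0 \<le> K n" "K n \<le> 1" for n
    using antimonoD[OF cesaro_kernel_antimono[of "1 - a"], of 0 n] a
    by (simp_all add: K_def cesaro_kernel_nonneg)
  have abs_d: "\<bar>d n\<bar> * (real n + 1) = (1 + s) * \<bar>f n\<bar>" for n
    using s by (simp add: d abs_mult)
  have summ_d: "summable (\<lambda>n. \<bar>d n\<bar>)"
  proof (rule summable_comparison_test')
    show "summable (\<lambda>n. (1 + s) * \<bar>f n\<bar>)" by (intro summable_mult summ_f)
    fix n
    have "\<bar>d n\<bar> * 1 \<le> \<bar>d n\<bar> * (real n + 1)" by (intro mult_left_mono) auto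
    then show "norm \<bar>d n\<bar> \<le> (1 + s) * \<bar>f n\<bar>" by (simp add: abs_d)
  qed
  have w_sums: "(\<lambda>i. K i * d (j + i)) sums w j" for j
  proof -
    have part: "(\<Sum>i\<le>n. K i * d (j + i))
        = (\<Sum>i\<le>n. cesaro_kernel (- a) i * f (j + i)) - K n * f (j + Suc n)" for n
    proof (induction n)
      case (Suc n)
      have "K (Suc n) - K n = cesaro_kernel (- a) (Suc n)"
        using cesaro_kernel_diff[of "1 - a" n] by (simp add: K_def)
      then show ?case using Suc by (simp add: d_def algebra_simps)
    qed (simp add: d_def K_def)
    have "summable (\<lambda>i. K i * d (j + i))"
    proof (rule summable_comparison_test')
      show "summable (\<lambda>i. \<bar>d (i + j)\<bar>)" by (rule summable_ignore_initial_segment[OF summ_d])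
      show "norm (K i * d (j + i)) \<le> \<bar>d (i + j)\<bar>" for i
        using K[of i] by (simp add: abs_mult mult_left_le_one_le add.commute)
    qed
    then have "(\<lambda>n. \<Sum>i\<le>n. K i * d (j + i)) \<longlonglongrightarrow> (\<Sum>i. K i * d (j + i))"
      by (rule summable_LIMSEQ')
    moreover have "(\<lambda>n. K n * f (j + Suc n)) \<longlonglongrightarrow> 0"
    proof (rule Lim_null_comparison)
      show "(\<lambda>n. \<bar>f (n + Suc j)\<bar>) \<longlonglongrightarrow> 0"
        using LIMSEQ_ignore_initial_segment[OF f0, of "Suc j"] tendsto_rabs_zero by blast
      show "\<forall>\<^sub>F n in sequentially. norm (K n * f (j + Suc n)) \<le> \<bar>f (n + Suc j)\<bar>"
        using K by (auto simp: abs_mult mult_left_le_one_le add.commute)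
    qed
    ultimately have "(\<lambda>n. (\<Sum>i\<le>n. K i * d (j + i)) + K n * f (j + Suc n))
        \<longlonglongrightarrow> (\<Sum>i. K i * d (j + i)) + 0"
      by (rule tendsto_add)
    then have "(\<lambda>i. cesaro_kernel (- a) i * f (j + i)) sums (\<Sum>i. K i * d (j + i))"
      by (simp add: part sums_def_le)
    then have "w j = (\<Sum>i. K i * d (j + i))"
      by (simp add: w_def weyl_difference_def sums_iff)
    then show ?thesis using \<open>summable (\<lambda>i. K i * d (j + i))\<close> by (simp add: summable_sums)
  qed
  have U_le: "norm (U n) \<le> C * (real n + 1)" for n
    unfolding U_def using norm_cesaro_sum_1_le(2)[OF a C(2)] .
  have dU: "norm (d n *\<^sub>R U n) \<le> g n" for n
  proof -
    have "norm (d n *\<^sub>R U n) \<le> \<bar>d n\<bar> * (C * (real n + 1))"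
      using U_le by (simp add: mult_left_mono)
    also have "\<dots> = C * (\<bar>d n\<bar> * (real n + 1))" by simp
    also have "\<dots> = g n" unfolding abs_d by (simp add: g_def)
    finally show ?thesis .
  qed
  define L where "L = (\<Sum>n. d n *\<^sub>R U n)"
  have "summable (\<lambda>n. d n *\<^sub>R U n)"
    by (rule summable_comparison_test'[OF summ_g dU])
  then have L: "(\<lambda>J. \<Sum>n\<le>J. d n *\<^sub>R U n) \<longlonglongrightarrow> L"
    unfolding L_def by (rule summable_LIMSEQ')
  have "(\<lambda>J. (\<Sum>j\<le>J. w j *\<^sub>R S j) - (\<Sum>n\<le>J. d n *\<^sub>R U n)) \<longlonglongrightarrow> 0"
  proof (rule Lim_null_comparison)
    have "(\<lambda>J. suminf g - (\<Sum>i<Suc J. g i)) \<longlonglongrightarrow> suminf g - suminf g"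
      by (intro tendsto_intros LIMSEQ_Suc summable_LIMSEQ summ_g)
    then show "(\<lambda>J. suminf g - (\<Sum>i<Suc J. g i)) \<longlonglongrightarrow> 0" by simp
    show "\<forall>\<^sub>F J in sequentially. norm ((\<Sum>j\<le>J. w j *\<^sub>R S j) - (\<Sum>n\<le>J. d n *\<^sub>R U n))
        \<le> suminf g - (\<Sum>i<Suc J. g i)"
    proof (intro always_eventually allI)
      fix J
      have "(\<Sum>n\<le>J. d n *\<^sub>R U n) = (\<Sum>n\<le>J. \<Sum>j\<le>n. (K (n - j) * d n) *\<^sub>R S j)"
        using cesaro_sum_add[of "1 - a" a T]
        by (simp add: U_def K_def S_def scaleR_sum_right mult.commute)
      also have "\<dots> = (\<Sum>j\<le>J. (\<Sum>i\<le>J - j. K i * d (j + i)) *\<^sub>R S j)"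
        by (subst sum_triangle_swap) (simp add: scaleR_sum_left)
      finally have eq: "(\<Sum>j\<le>J. w j *\<^sub>R S j) - (\<Sum>n\<le>J. d n *\<^sub>R U n)
          = (\<Sum>j\<le>J. (w j - (\<Sum>i\<le>J - j. K i * d (j + i))) *\<^sub>R S j)"
        by (simp add: scaleR_diff_left sum_subtractf)
      have "(\<lambda>i. \<Sum>j\<le>J. (K (i + Suc J - j) * d (i + Suc J)) *\<^sub>R S j)
          sums (\<Sum>j\<le>J. (w j - (\<Sum>i\<le>J - j. K i * d (j + i))) *\<^sub>R S j)"
      proof (rule sums_sum)
        fix j assume j: "j \<in> {..J}"
        have "(\<lambda>i. K (i + Suc (J - j)) * d (j + (i + Suc (J - j))))
            sums (w j - (\<Sum>i<Suc (J - j). K i * d (j + i)))"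
          by (rule sums_split_initial_segment[OF w_sums])
        moreover have "i + Suc (J - j) = i + Suc J - j" "j + (i + Suc (J - j)) = i + Suc J" for i
          using j by auto
        ultimately show "(\<lambda>i. (K (i + Suc J - j) * d (i + Suc J)) *\<^sub>R S j)
            sums ((w j - (\<Sum>i\<le>J - j. K i * d (j + i))) *\<^sub>R S j)"
          by (intro sums_scaleR_left) (simp only: lessThan_Suc_atMost)
      qed
      then have "norm (\<Sum>j\<le>J. (w j - (\<Sum>i\<le>J - j. K i * d (j + i))) *\<^sub>R S j)
          = norm (\<Sum>i. \<Sum>j\<le>J. (K (i + Suc J - j) * d (i + Suc J)) *\<^sub>R S j)"
        by (simp only: sums_iff)
      also have "\<dots> \<le> (\<Sum>i. g (i + Suc J))"
      proof (rule norm_suminf_le)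
        show "summable (\<lambda>i. g (i + Suc J))" by (rule summable_ignore_initial_segment[OF summ_g])
        fix i
        define n where "n = i + Suc J"
        have "norm (\<Sum>j\<le>J. (K (n - j) * d n) *\<^sub>R S j) \<le> (\<Sum>j\<le>J. \<bar>d n\<bar> * (K (n - j) * norm (S j)))"
          by (intro order_trans[OF norm_sum] sum_mono) (simp add: abs_mult K mult_ac)
        also have "\<dots> \<le> (\<Sum>j\<le>n. \<bar>d n\<bar> * (K (n - j) * norm (S j)))"
          using K by (intro sum_mono2) (auto simp: n_def)
        also have "\<dots> = \<bar>d n\<bar> * (\<Sum>j\<le>n. K (n - j) * norm (S j))"
          by (simp add: sum_distrib_left)
        also have "\<dots> \<le> \<bar>d n\<bar> * (C * (real n + 1))"
          unfolding K_def S_def by (intro mult_left_mono norm_cesaro_sum_1_le(1)[OF a C(2)]) auto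
        also have "\<dots> = C * (\<bar>d n\<bar> * (real n + 1))" by simp
        also have "\<dots> = g n" unfolding abs_d by (simp add: g_def)
        finally show "norm (\<Sum>j\<le>J. (K (i + Suc J - j) * d (i + Suc J)) *\<^sub>R S j) \<le> g (i + Suc J)"
          by (simp add: n_def)
      qed
      also have "\<dots> = suminf g - (\<Sum>i<Suc J. g i)"
        by (rule suminf_minus_initial_segment[OF summ_g])
      finally show "norm ((\<Sum>j\<le>J. w j *\<^sub>R S j) - (\<Sum>n\<le>J. d n *\<^sub>R U n))
          \<le> suminf g - (\<Sum>i<Suc J. g i)"
        unfolding eq .
    qed
  qed
  from tendsto_add[OF this L] have "(\<lambda>j. w j *\<^sub>R S j) sums L"
    by (simp add: sums_def_le)
  then have fp: "frac_power a s T = L"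
    by (simp add: frac_power_def w_def S_def f_def sums_iff)
  have abel: "(\<Sum>n\<le>J. f n *\<^sub>R blinfun_pow T n) = (\<Sum>n\<le>J. d n *\<^sub>R U n) + f (Suc J) *\<^sub>R U J" for J
    by (induction J) (simp_all add: U_def cesaro_sum_1 d_def algebra_simps)
  have "(\<lambda>J. f (Suc J) *\<^sub>R U J) \<longlonglongrightarrow> 0"
  proof (rule Lim_null_comparison)
    have "(\<lambda>J. real (Suc J) powr (- s)) \<longlonglongrightarrow> 0"
      using s by (intro LIMSEQ_Suc tendsto_neg_powr filterlim_real_sequentially) auto
    then have "(\<lambda>J. C * s * real (Suc J) powr (- s)) \<longlonglongrightarrow> C * s * 0"
      by (intro tendsto_mult_left)
    then show "(\<lambda>J. C * s * real (Suc J) powr (- s)) \<longlonglongrightarrow> 0" by simp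
    show "\<forall>\<^sub>F J in sequentially. norm (f (Suc J) *\<^sub>R U J) \<le> C * s * real (Suc J) powr (- s)"
    proof (intro always_eventually allI)
      fix J
      have "f (Suc J) = - s / (real J + 1) * cesaro_kernel (1 - s) J"
        using cesaro_kernel_lower_Suc[of "1 - s" J] by (simp add: f_def)
      then have *: "\<bar>f (Suc J)\<bar> * (real J + 1) = s * cesaro_kernel (1 - s) J"
        using s by (simp add: abs_mult cesaro_kernel_nonneg)
      have "norm (f (Suc J) *\<^sub>R U J) \<le> \<bar>f (Suc J)\<bar> * (C * (real J + 1))"
        using U_le by (simp add: mult_left_mono)
      also have "\<dots> = C * s * cesaro_kernel (1 - s) J" using * by (simp add: mult_ac)
      also have "\<dots> \<le> C * s * real (Suc J) powr (- s)"
        using cesaro_kernel_le_powr[of "1 - s" J] s C(1) by (intro mult_left_mono) (auto simp: add.commute)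
      finally show "norm (f (Suc J) *\<^sub>R U J) \<le> C * s * real (Suc J) powr (- s)" .
    qed
  qed
  from tendsto_add[OF L this] show ?thesis
    by (simp add: sums_def_le fp abel flip: f_def)
qed

section \<open>The remainder of the binomial series\<close>

text \<open>\<open>remainder_coeff s N i\<close> is the coefficient of \<open>z\<^bsup>N + 1 + i\<^esup>\<close> in
  \<open>1 - (\<Sum>n\<le>N. k\<^sup>s(n) z\<^sup>n) (1 - z)\<^sup>s\<close>.\<close>

definition remainder_coeff :: "real \<Rightarrow> nat \<Rightarrow> nat \<Rightarrow> real" where
  "remainder_coeff s N i =
     s * cesaro_kernel (s + 1) N * cesaro_kernel (1 - s) i / (real N + 1 + real i)"

definition binomial_partial_sum ::
    "real \<Rightarrow> ('a::real_normed_vector \<Rightarrow>\<^sub>L 'a) \<Rightarrow> nat \<Rightarrow> 'a \<Rightarrow>\<^sub>L 'a" where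
  "binomial_partial_sum s T N = (\<Sum>n\<le>N. cesaro_kernel s n *\<^sub>R blinfun_pow T n)"

lemma remainder_coeff_nonneg: "0 < s \<Longrightarrow> s < 1 \<Longrightarrow> 0 \<le> remainder_coeff s N i"
  by (simp add: remainder_coeff_def cesaro_kernel_nonneg)

lemma remainder_coeff_le:
  assumes "0 < s" "s < 1"
  shows "remainder_coeff s N i
       \<le> (real N + 1) powr s * (real i + 1) powr (- s) * inverse (real N + 1 + real i)"
proof -
  have "s * cesaro_kernel (s + 1) N * cesaro_kernel (1 - s) i
      \<le> (real N + 1) powr s * (real i + 1) powr (- s)"
    using cesaro_kernel_plus_1_le_powr[of s N] cesaro_kernel_le_powr[of "1 - s" i] assms
    by (intro mult_mono) (auto simp: cesaro_kernel_nonneg)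
  then show ?thesis
    by (simp add: remainder_coeff_def divide_inverse mult_right_mono)
qed

lemma remainder_coeff_diff:
  assumes "0 < s" "s < 1"
  shows "0 \<le> remainder_coeff s N i - remainder_coeff s N (Suc i)"
    and "remainder_coeff s N i - remainder_coeff s N (Suc i) \<le> 2 * remainder_coeff s N i / (real i + 1)"
proof -
  define u where "u = s / (real i + 1)"
  define v where "v = 1 / (real N + 2 + real i)"
  have u: "0 \<le> u" "u \<le> 1" "u \<le> 1 / (real i + 1)"
    using assms by (auto simp: u_def divide_right_mono)
  have v: "0 \<le> v" "v \<le> 1" "v \<le> 1 / (real i + 1)"
    by (auto simp: v_def field_simps)
  have "remainder_coeff s N (Suc i) = remainder_coeff s N i * ((1 - u) * (1 - v))"
  proof -
    have 1: "cesaro_kernel (1 - s) (Suc i) = (1 - u) * cesaro_kernel (1 - s) i"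
      by (simp add: cesaro_kernel_Suc u_def field_simps)
    have 2: "1 / (real N + 1 + real (Suc i)) = (1 - v) * (1 / (real N + 1 + real i))"
      by (simp add: v_def divide_simps algebra_simps)
    have "remainder_coeff s N (Suc i) = s * cesaro_kernel (s + 1) N * cesaro_kernel (1 - s) (Suc i)
        * (1 / (real N + 1 + real (Suc i)))"
      by (simp add: remainder_coeff_def)
    then show ?thesis unfolding 1 2 by (simp add: remainder_coeff_def)
  qed
  then have eq: "remainder_coeff s N i - remainder_coeff s N (Suc i)
      = remainder_coeff s N i * (u + v - u * v)"
    by (simp add: algebra_simps)
  have "u * v \<le> v" "0 \<le> u * v" using u v by (auto simp: mult_left_le_one_le)
  moreover have "2 / (real i + 1) = 1 / (real i + 1) + 1 / (real i + 1)" by simp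
  ultimately have w: "0 \<le> u + v - u * v" "u + v - u * v \<le> 2 / (real i + 1)"
    using u v by linarith+
  show "0 \<le> remainder_coeff s N i - remainder_coeff s N (Suc i)"
    unfolding eq using w remainder_coeff_nonneg[OF assms] by simp
  show "remainder_coeff s N i - remainder_coeff s N (Suc i) \<le> 2 * remainder_coeff s N i / (real i + 1)"
    unfolding eq using mult_left_mono[OF w(2) remainder_coeff_nonneg[OF assms]] by (simp add: mult_ac)
qed

lemma norm_sums_le_abel:
  fixes X :: "nat \<Rightarrow> 'a::real_normed_vector" and r g :: "nat \<Rightarrow> real"
  assumes X: "(\<lambda>i. r i *\<^sub>R X i) sums Y"
    and r: "\<And>i. 0 \<le> r i - r (Suc i)" "\<And>i. 0 \<le> r i"
    and g: "\<And>i. norm (\<Sum>l\<le>i. X l) \<le> g i"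
    and lim: "(\<lambda>i. r i * g i) \<longlonglongrightarrow> 0"
    and B: "\<And>n. (\<Sum>i<n. (r i - r (Suc i)) * g i) \<le> B"
  shows "norm Y \<le> B"
proof -
  have abel: "(\<Sum>i\<le>n. r i *\<^sub>R X i)
      = (\<Sum>i\<le>n. (r i - r (Suc i)) *\<^sub>R (\<Sum>l\<le>i. X l)) + r (Suc n) *\<^sub>R (\<Sum>l\<le>n. X l)" for n
    by (induction n) (simp_all add: algebra_simps)
  have "norm (\<Sum>i\<le>n. r i *\<^sub>R X i) \<le> B + r n * g n" for n
  proof -
    have "norm (\<Sum>i\<le>n. r i *\<^sub>R X i) \<le> (\<Sum>i\<le>n. (r i - r (Suc i)) * g i) + r (Suc n) * g n"
      unfolding abel
    proof (intro order_trans[OF norm_triangle_ineq] add_mono order_trans[OF norm_sum] sum_mono)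
      fix i
      show "norm ((r i - r (Suc i)) *\<^sub>R (\<Sum>l\<le>i. X l)) \<le> (r i - r (Suc i)) * g i"
        using r(1)[of i] g[of i] by (simp add: mult_left_mono)
      show "norm (r (Suc n) *\<^sub>R (\<Sum>l\<le>n. X l)) \<le> r (Suc n) * g n"
        using r(2)[of "Suc n"] g[of n] by (simp add: mult_left_mono)
    qed
    moreover have "r (Suc n) * g n \<le> r n * g n"
      using r(1)[of n] order_trans[OF norm_ge_zero g] by (intro mult_right_mono) auto
    ultimately show ?thesis
      using B[of "Suc n"] by (simp add: lessThan_Suc_atMost)
  qed
  moreover have "(\<lambda>n. B + r n * g n) \<longlonglongrightarrow> B + 0"
    by (intro tendsto_intros lim)
  moreover have "(\<lambda>n. norm (\<Sum>i\<le>n. r i *\<^sub>R X i)) \<longlonglongrightarrow> norm Y"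
    using X by (intro tendsto_norm) (simp add: sums_def_le)
  ultimately show ?thesis
    using LIMSEQ_le[of "\<lambda>n. norm (\<Sum>i\<le>n. r i *\<^sub>R X i)" "norm Y" "\<lambda>n. B + r n * g n" B] by auto
qed

lemma norm_remainder_sums_le:
  fixes X :: "nat \<Rightarrow> 'a::real_normed_vector"
  assumes s: "0 < s" "s < 1" and a: "a \<le> 1" "c \<le> 1 - a" and "C \<ge> 0"
    and X: "(\<lambda>i. remainder_coeff s N i *\<^sub>R X i) sums Y"
    and g: "\<And>i. norm (\<Sum>l\<le>i. X l) \<le> C * ((real N + 1 + real i) powr a * (real i + 1) powr c)"
    and B: "\<And>n. (\<Sum>i<n. (real i + 1) powr (c - s - 1) * (real N + 1 + real i) powr (a - 1)) \<le> B"
  shows "norm Y \<le> 2 * C * (real N + 1) powr s * B"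
proof (rule norm_sums_le_abel[OF X remainder_coeff_diff(1)[OF s] remainder_coeff_nonneg[OF s] g])
  define g where "g i = C * ((real N + 1 + real i) powr a * (real i + 1) powr c)" for i :: nat
  have rg: "remainder_coeff s N i * g i
      \<le> C * (real N + 1) powr s * ((real i + 1) powr (c - s) * (real N + 1 + real i) powr (a - 1))"
    for i
  proof -
    have "remainder_coeff s N i * g i \<le> ((real N + 1) powr s * (real i + 1) powr (- s)
        * inverse (real N + 1 + real i)) * g i"
      using \<open>C \<ge> 0\<close> by (intro mult_right_mono remainder_coeff_le s) (auto simp: g_def)
    also have "\<dots> = C * (real N + 1) powr s * (((real i + 1) powr (- s) * (real i + 1) powr c)
        * ((real N + 1 + real i) powr (- 1) * (real N + 1 + real i) powr a))"
      by (simp add: g_def powr_minus[of _ 1] divide_inverse mult_ac)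
    also have "\<dots> = C * (real N + 1) powr s *
        ((real i + 1) powr (c - s) * (real N + 1 + real i) powr (a - 1))"
      by (simp add: powr_diff powr_minus divide_inverse)
    finally show ?thesis .
  qed
  have g_nonneg: "0 \<le> g i" for i using \<open>C \<ge> 0\<close> by (simp add: g_def)
  show "(\<lambda>i. remainder_coeff s N i * (C * ((real N + 1 + real i) powr a * (real i + 1) powr c)))
      \<longlonglongrightarrow> 0"
    unfolding g_def[symmetric]
  proof (rule Lim_null_comparison)
    have "(\<lambda>i. real (Suc i) powr (- s)) \<longlonglongrightarrow> 0"
      using s by (intro LIMSEQ_Suc tendsto_neg_powr filterlim_real_sequentially) auto
    then have "(\<lambda>i. C * (real N + 1) powr s * real (Suc i) powr (- s)) \<longlonglongrightarrow> C * (real N + 1) powr s * 0"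
      by (intro tendsto_mult_left)
    then show "(\<lambda>i. C * (real N + 1) powr s * (real i + 1) powr (- s)) \<longlonglongrightarrow> 0"
      by (simp add: add.commute)
    show "\<forall>\<^sub>F i in sequentially. norm (remainder_coeff s N i * g i)
        \<le> C * (real N + 1) powr s * (real i + 1) powr (- s)"
    proof (intro always_eventually allI)
      fix i
      have "(real i + 1) powr (c - s) * (real N + 1 + real i) powr (a - 1)
          \<le> (real i + 1) powr (c - s) * (real i + 1) powr (a - 1)"
        using a by (intro mult_left_mono powr_mono2') auto
      also have "\<dots> = (real i + 1) powr (c - s + (a - 1))" by (simp flip: powr_add)
      also have "\<dots> \<le> (real i + 1) powr (- s)"
        using a by (intro powr_mono) auto
      finally have "C * (real N + 1) powr s * ((real i + 1) powr (c - s) * (real N + 1 + real i) powr (a - 1))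
          \<le> C * (real N + 1) powr s * (real i + 1) powr (- s)"
        using \<open>C \<ge> 0\<close> by (intro mult_left_mono) auto
      then show "norm (remainder_coeff s N i * g i) \<le> C * (real N + 1) powr s * (real i + 1) powr (- s)"
        using rg[of i] remainder_coeff_nonneg[OF s, of N i] g_nonneg[of i] by simp
    qed
  qed
  fix n
  have "(\<Sum>i<n. (remainder_coeff s N i - remainder_coeff s N (Suc i)) * g i)
      \<le> (\<Sum>i<n. 2 * C * (real N + 1) powr s *
          ((real i + 1) powr (c - s - 1) * (real N + 1 + real i) powr (a - 1)))"
  proof (rule sum_mono)
    fix i
    have "(remainder_coeff s N i - remainder_coeff s N (Suc i)) * g i
        \<le> (2 * remainder_coeff s N i / (real i + 1)) * g i"
      by (intro mult_right_mono remainder_coeff_diff s g_nonneg)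
    also have "\<dots> = 2 / (real i + 1) * (remainder_coeff s N i * g i)" by simp
    also have "\<dots> \<le> 2 / (real i + 1) * (C * (real N + 1) powr s *
        ((real i + 1) powr (c - s) * (real N + 1 + real i) powr (a - 1)))"
      by (intro mult_left_mono rg) auto
    also have "\<dots> = 2 * C * (real N + 1) powr s *
          ((real i + 1) powr (c - s - 1) * (real N + 1 + real i) powr (a - 1))"
      by (simp add: powr_diff[of "real i + 1" _ 1])
    finally show "(remainder_coeff s N i - remainder_coeff s N (Suc i)) * g i \<le> \<dots>" .
  qed
  also have "\<dots> = 2 * C * (real N + 1) powr s *
      (\<Sum>i<n. (real i + 1) powr (c - s - 1) * (real N + 1 + real i) powr (a - 1))"
    by (simp only: sum_distrib_left)
  also have "\<dots> \<le> 2 * C * (real N + 1) powr s * B"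
    using \<open>C \<ge> 0\<close> by (intro mult_left_mono B) auto
  finally show "(\<Sum>i<n. (remainder_coeff s N i - remainder_coeff s N (Suc i))
      * (C * ((real N + 1 + real i) powr a * (real i + 1) powr c)))
      \<le> 2 * C * (real N + 1) powr s * B"
    unfolding g_def .
qed

lemma blinfun_pow_commute_power_series:
  fixes A :: "'a::banach \<Rightarrow>\<^sub>L 'a"
  assumes "(\<lambda>m. f m *\<^sub>R blinfun_pow T m) sums A"
  shows "blinfun_pow T n o\<^sub>L A = A o\<^sub>L blinfun_pow T n"
proof -
  have "(\<lambda>m. blinfun_pow T n o\<^sub>L (f m *\<^sub>R blinfun_pow T m)) sums (blinfun_pow T n o\<^sub>L A)"
    by (intro bounded_linear.sums[OF _ assms]
        bounded_bilinear.bounded_linear_right[OF bounded_bilinear_blinfun_compose])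
  moreover have "(\<lambda>m. (f m *\<^sub>R blinfun_pow T m) o\<^sub>L blinfun_pow T n) sums (A o\<^sub>L blinfun_pow T n)"
    by (intro bounded_linear.sums[OF _ assms]
        bounded_bilinear.bounded_linear_left[OF bounded_bilinear_blinfun_compose])
  moreover have "blinfun_pow T n o\<^sub>L (f m *\<^sub>R blinfun_pow T m)
      = (f m *\<^sub>R blinfun_pow T m) o\<^sub>L blinfun_pow T n" for m
    using blinfun_pow_add[of T m n] blinfun_pow_add[of T n m]
    by (simp add: add.commute bounded_bilinear.scaleR_left[OF bounded_bilinear_blinfun_compose]
        bounded_bilinear.scaleR_right[OF bounded_bilinear_blinfun_compose])
  ultimately show ?thesis
    using sums_unique2 by auto
qed

lemma remainder_sums:
  fixes A :: "'a::banach \<Rightarrow>\<^sub>L 'a"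
  assumes A: "(\<lambda>m. cesaro_kernel (- s) m *\<^sub>R blinfun_pow T m) sums A"
  shows "(\<lambda>i. remainder_coeff s N i *\<^sub>R blinfun_pow T (Suc N + i))
      sums (id_blinfun - (binomial_partial_sum s T N o\<^sub>L A))"
proof -
  define h where "h n m = (if m < n then 0 else cesaro_kernel (- s) (m - n))" for n m
  define c where "c m = (\<Sum>n\<le>N. cesaro_kernel s n * h n m)" for m
  have h: "(\<lambda>m. h n m *\<^sub>R blinfun_pow T m) sums (blinfun_pow T n o\<^sub>L A)" for n
  proof -
    have "(\<lambda>m. blinfun_pow T n o\<^sub>L (cesaro_kernel (- s) m *\<^sub>R blinfun_pow T m)) sums (blinfun_pow T n o\<^sub>L A)"
      by (intro bounded_linear.sums[OF _ A]
          bounded_bilinear.bounded_linear_right[OF bounded_bilinear_blinfun_compose])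
    moreover have "blinfun_pow T n o\<^sub>L (cesaro_kernel (- s) m *\<^sub>R blinfun_pow T m)
        = h n (m + n) *\<^sub>R blinfun_pow T (m + n)" for m
      by (simp add: h_def add.commute[of m n] blinfun_pow_add
          bounded_bilinear.scaleR_right[OF bounded_bilinear_blinfun_compose])
    ultimately have "(\<lambda>m. h n (m + n) *\<^sub>R blinfun_pow T (m + n)) sums (blinfun_pow T n o\<^sub>L A)"
      by simp
    then show ?thesis
      by (subst (asm) sums_zero_iff_shift) (simp_all add: h_def)
  qed
  have "(\<lambda>m. \<Sum>n\<le>N. cesaro_kernel s n *\<^sub>R (h n m *\<^sub>R blinfun_pow T m))
      sums (\<Sum>n\<le>N. cesaro_kernel s n *\<^sub>R (blinfun_pow T n o\<^sub>L A))"
    by (intro sums_sum sums_scaleR_right h)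
  moreover have "(\<Sum>n\<le>N. cesaro_kernel s n *\<^sub>R (h n m *\<^sub>R blinfun_pow T m)) = c m *\<^sub>R blinfun_pow T m" for m
    by (simp add: c_def scaleR_sum_left)
  moreover have "(\<Sum>n\<le>N. cesaro_kernel s n *\<^sub>R (blinfun_pow T n o\<^sub>L A)) = binomial_partial_sum s T N o\<^sub>L A"
    by (simp add: binomial_partial_sum_def
        bounded_bilinear.sum_left[OF bounded_bilinear_blinfun_compose]
        bounded_bilinear.scaleR_left[OF bounded_bilinear_blinfun_compose])
  ultimately have "(\<lambda>m. c m *\<^sub>R blinfun_pow T m) sums (binomial_partial_sum s T N o\<^sub>L A)"
    by simp
  from sums_split_initial_segment[OF this, of "Suc N"]
  have tail: "(\<lambda>i. c (i + Suc N) *\<^sub>R blinfun_pow T (i + Suc N))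
      sums ((binomial_partial_sum s T N o\<^sub>L A) - (\<Sum>m<Suc N. c m *\<^sub>R blinfun_pow T m))" .
  have c_small: "c m = (if m = 0 then 1 else 0)" if "m \<le> N" for m
  proof -
    have "c m = (\<Sum>n\<le>m. cesaro_kernel s n * h n m)"
      unfolding c_def using that by (intro sum.mono_neutral_right) (auto simp: h_def)
    also have "\<dots> = (\<Sum>n\<le>m. cesaro_kernel s n * cesaro_kernel (- s) (m - n))"
      by (intro sum.cong refl) (auto simp: h_def)
    also have "\<dots> = cesaro_kernel 0 m" by (simp add: cesaro_kernel_convolution)
    also have "\<dots> = (if m = 0 then 1 else 0)" by (simp add: cesaro_kernel_def pochhammer_0_left)
    finally show ?thesis .
  qed
  have "(\<Sum>m<Suc N. c m *\<^sub>R blinfun_pow T m) = (\<Sum>m<Suc N. if m = 0 then id_blinfun else 0)"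
    by (intro sum.cong refl) (auto simp: c_small)
  also have "\<dots> = id_blinfun" by (simp del: sum.lessThan_Suc)
  finally have init: "(\<Sum>m<Suc N. c m *\<^sub>R blinfun_pow T m) = id_blinfun" .
  have c_large: "c (i + Suc N) = - remainder_coeff s N i" for i
  proof -
    have "c (i + Suc N) = (\<Sum>n\<le>N. cesaro_kernel s n * cesaro_kernel (- s) (i + Suc N - n))"
      unfolding c_def by (intro sum.cong refl) (auto simp: h_def)
    also have "\<dots> = - remainder_coeff s N i"
      by (subst sum_cesaro_kernel_inverse) (simp_all add: remainder_coeff_def add_ac)
    finally show ?thesis .
  qed
  show ?thesis
    using sums_minus[OF tail] by (simp only: init c_large) (simp add: add.commute)
qed

lemma binomial_partial_sum_frac_power_tendsto:
  fixes T :: "'a::banach \<Rightarrow>\<^sub>L 'a"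
  assumes s: "0 < s" "s < 1" and a: "0 \<le> a" "a < 1 - s" and T: "cesaro_bounded a T"
    and dense: "closure (range (blinfun_apply (id_blinfun - T))) = UNIV"
  shows "(\<lambda>N. binomial_partial_sum s T N (frac_power a s T y)) \<longlonglongrightarrow> y"
proof -
  define R where "R N = id_blinfun - (binomial_partial_sum s T N o\<^sub>L frac_power a s T)" for N
  have R: "(\<lambda>i. remainder_coeff s N i *\<^sub>R blinfun_pow T (Suc N + i)) sums R N" for N
    unfolding R_def using s a T by (intro remainder_sums frac_power_sums) auto
  obtain C where C: "C \<ge> 0" "\<And>N i. norm (\<Sum>l\<le>i. blinfun_pow T (Suc N + l))
        \<le> C * ((real N + 1 + real i) powr a * (real i + 1) powr (1 - a))"
    using cesaro_bounded_growth[of a T] s a T by auto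
  define B where "B = 2 * C * (1 / (1 - s - a) + 1 / s)"
  have B: "norm (R N) \<le> B" for N
  proof -
    have "norm (R N) \<le> 2 * C * (real N + 1) powr s
        * ((1 / (1 - s - a) + 1 / s) * (real N + 1) powr (- s))"
    proof (rule norm_remainder_sums_le[OF s _ _ C(1) R C(2)])
      have "1 - a - s - 1 = - s - a" by simp
      then show "(\<Sum>i<n. (real i + 1) powr (1 - a - s - 1) * (real N + 1 + real i) powr (a - 1))
          \<le> (1 / (1 - s - a) + 1 / s) * (real N + 1) powr (- s)" for n
        using sum_beta_le[OF s(1) a] by (simp only:)
    qed (use s a in auto)
    also have "\<dots> = B * ((real N + 1) powr s * (real N + 1) powr (- s))"
      by (simp add: B_def mult_ac)
    also have "\<dots> = B" by (simp flip: powr_add)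
    finally show ?thesis .
  qed
  have B_pos: "0 \<le> B" using B[of 0] norm_ge_zero order_trans by blast
  have on_range: "(\<lambda>N. R N ((id_blinfun - T) z)) \<longlonglongrightarrow> 0" for z
  proof -
    have pow: "norm (blinfun_pow T (Suc n) z) \<le> C * (real n + 1) powr a * norm z" for n
      using C(2)[of 0 n] norm_blinfun[of "blinfun_pow T (Suc n)" z]
        mult_right_mono[OF C(2)[where i = 0 and N = n], of "norm z"]
      by simp
    define D where "D = 3 * C * norm z"
    have D: "0 \<le> D" using C by (simp add: D_def)
    have bound: "norm (R N ((id_blinfun - T) z))
        \<le> 2 * D * (1 + 1 / s) * (real N + 1) powr (s + a - 1)" for N
    proof -
      have "norm (R N ((id_blinfun - T) z))
          \<le> 2 * D * (real N + 1) powr s * ((1 + 1 / s) * (real N + 1) powr (a - 1))"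
      proof (rule norm_remainder_sums_le[OF s, where a = a and c = 0])
        show "(\<lambda>i. remainder_coeff s N i *\<^sub>R blinfun_pow T (Suc N + i) ((id_blinfun - T) z))
            sums R N ((id_blinfun - T) z)"
          using bounded_linear.sums[OF blinfun.bounded_linear_left R]
          by (simp add: blinfun.scaleR_left)
      next
        fix i
        have "(\<Sum>l\<le>i. blinfun_pow T (Suc N + l) ((id_blinfun - T) z))
            = blinfun_pow T (Suc N) z - blinfun_pow T (Suc (Suc N + i)) z"
          by (induction i) (simp_all add: blinfun.diff_left blinfun.diff_right blinfun_pow_apply
              funpow_swap1)
        also have "norm \<dots> \<le> C * (real N + 1) powr a * norm z
            + C * (real (Suc N + i) + 1) powr a * norm z"
          by (intro order_trans[OF norm_triangle_ineq4] add_mono pow)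
        also have "\<dots> \<le> C * (real N + 1 + real i) powr a * norm z
            + C * (2 * (real N + 1 + real i) powr a) * norm z"
        proof (intro add_mono mult_right_mono mult_left_mono)
          show "(real N + 1) powr a \<le> (real N + 1 + real i) powr a"
            using a by (intro powr_mono2) auto
          have "(real (Suc N + i) + 1) powr a \<le> (2 * (real N + 1 + real i)) powr a"
            using a by (intro powr_mono2) auto
          also have "\<dots> = 2 powr a * (real N + 1 + real i) powr a" by (rule powr_mult)
          also have "\<dots> \<le> 2 * (real N + 1 + real i) powr a"
            using powr_mono[of a 1 2] a s by (intro mult_right_mono) auto
          finally show "(real (Suc N + i) + 1) powr a \<le> 2 * (real N + 1 + real i) powr a" .
        qed (use C in auto)
        also have "\<dots> = D * ((real N + 1 + real i) powr a * (real i + 1) powr 0)"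
          by (simp add: D_def)
        finally show "norm (\<Sum>l\<le>i. blinfun_pow T (Suc N + l) ((id_blinfun - T) z))
            \<le> D * ((real N + 1 + real i) powr a * (real i + 1) powr 0)" .
      next
        fix n
        have "(\<Sum>i<n. (real i + 1) powr (0 - s - 1) * (real N + 1 + real i) powr (a - 1))
            \<le> (\<Sum>i<n. (real i + 1) powr (- s - 1) * (real N + 1) powr (a - 1))"
          using a s by (intro sum_mono mult_mono powr_mono2') auto
        also have "\<dots> = (\<Sum>i<n. (real i + 1) powr (- s - 1)) * (real N + 1) powr (a - 1)"
          by (simp add: sum_distrib_right)
        also have "\<dots> \<le> (1 + 1 / s) * (real N + 1) powr (a - 1)"
        proof (rule mult_right_mono)
          have "(\<Sum>i<n. (real i + 1) powr (- s - 1)) \<le> (\<Sum>i<Suc n. (real i + 1) powr (- s - 1))"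
            by simp
          also have "\<dots> = 1 + (\<Sum>i<n. (1 + 1 + real i) powr (- s - 1))"
            by (subst sum.lessThan_Suc_shift) (simp add: add_ac)
          also have "\<dots> \<le> 1 + 1 / s"
            using sum_powr_tail_le[of 1 s n] s by (simp add: field_simps)
          finally show "(\<Sum>i<n. (real i + 1) powr (- s - 1)) \<le> 1 + 1 / s" .
        qed simp
        finally show "(\<Sum>i<n. (real i + 1) powr (0 - s - 1) * (real N + 1 + real i) powr (a - 1))
            \<le> (1 + 1 / s) * (real N + 1) powr (a - 1)" .
      qed (use s a D in auto)
      also have "\<dots> = 2 * D * (1 + 1 / s) * ((real N + 1) powr s * (real N + 1) powr (a - 1))"
        by simp
      also have "\<dots> = 2 * D * (1 + 1 / s) * (real N + 1) powr (s + a - 1)"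
        by (simp add: add_diff_eq flip: powr_add)
      finally show ?thesis .
    qed
    show ?thesis
    proof (rule Lim_null_comparison)
      show "\<forall>\<^sub>F N in sequentially. norm (R N ((id_blinfun - T) z))
          \<le> 2 * D * (1 + 1 / s) * (real N + 1) powr (s + a - 1)"
        using bound by simp
      have "(\<lambda>N. real (Suc N) powr (s + a - 1)) \<longlonglongrightarrow> 0"
        using s a by (intro LIMSEQ_Suc tendsto_neg_powr filterlim_real_sequentially) auto
      then have "(\<lambda>N. 2 * D * (1 + 1 / s) * real (Suc N) powr (s + a - 1)) \<longlonglongrightarrow> 2 * D * (1 + 1 / s) * 0"
        by (intro tendsto_mult_left)
      then show "(\<lambda>N. 2 * D * (1 + 1 / s) * (real N + 1) powr (s + a - 1)) \<longlonglongrightarrow> 0"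
        by (simp add: add.commute)
    qed
  qed
  have "(\<lambda>N. R N y) \<longlonglongrightarrow> 0"
  proof (rule LIMSEQ_I)
    fix e :: real assume e: "0 < e"
    have "0 < e / (2 * (B + 1))" using e B_pos by simp
    moreover have "y \<in> closure (range (blinfun_apply (id_blinfun - T)))" using dense by simp
    ultimately obtain z where z: "dist ((id_blinfun - T) z) y < e / (2 * (B + 1))"
      unfolding closure_approachable by blast
    define v where "v = (id_blinfun - T) z"
    obtain M where M: "\<And>N. N \<ge> M \<Longrightarrow> norm (R N v) < e / 2"
      using LIMSEQ_D[OF on_range[of z], of "e / 2"] e by (auto simp: v_def)
    have "norm (R N y - 0) < e" if "N \<ge> M" for N
    proof -
      have "norm (R N (y - v)) \<le> B * norm (y - v)"
        using norm_blinfun[of "R N" "y - v"] mult_right_mono[OF B, of "norm (y - v)" N] by simp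
      also have "\<dots> \<le> (B + 1) * norm (y - v)" by (simp add: distrib_right)
      also have "\<dots> < (B + 1) * (e / (2 * (B + 1)))"
        using z B_pos by (intro mult_strict_left_mono) (auto simp: v_def dist_norm norm_minus_commute)
      also have "\<dots> = e / 2" using B_pos by (simp add: field_simps)
      finally have "norm (R N (y - v)) < e / 2" .
      moreover have "R N y = R N (y - v) + R N v" by (simp add: blinfun.diff_right)
      ultimately show ?thesis
        using M[OF that] norm_triangle_ineq[of "R N (y - v)" "R N v"] by simp
    qed
    then show "\<exists>M. \<forall>N\<ge>M. norm (R N y - 0) < e" by blast
  qed
  then have "(\<lambda>N. y - R N y) \<longlonglongrightarrow> y - 0" by (intro tendsto_intros)
  then show ?thesis by (simp add: R_def blinfun.diff_left)
qed

lemma binomial_partial_sum_apply: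
  "binomial_partial_sum s T N x = (\<Sum>n\<le>N. cesaro_kernel s n *\<^sub>R blinfun_pow T n x)"
  by (simp add: binomial_partial_sum_def blinfun.sum_left blinfun.scaleR_left)

lemma binomial_partial_sum_commute_frac_power:
  fixes T :: "'a::banach \<Rightarrow>\<^sub>L 'a"
  assumes "0 < s" "s < 1" "0 \<le> a" "a \<le> 1" "cesaro_bounded a T"
  shows "frac_power a s T (binomial_partial_sum s T N x) = binomial_partial_sum s T N (frac_power a s T x)"
proof -
  have "frac_power a s T (blinfun_pow T n x) = blinfun_pow T n (frac_power a s T x)" for n
    using arg_cong[OF blinfun_pow_commute_power_series[OF frac_power_sums[OF assms], of n],
        of "\<lambda>A. blinfun_apply A x"] by simp
  then show ?thesis
    by (simp add: binomial_partial_sum_apply blinfun.sum_right blinfun.scaleR_right)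
qed

lemma complex_linear_blinfun_pow: "complex_linear T \<Longrightarrow> complex_linear (blinfun_pow T n)"
  by (induction n) (auto simp: complex_linear_def)

lemma bounded_linear_scaleC: "bounded_linear (\<lambda>x. c *\<^sub>C x :: 'a::complex_normed_vector)"
  by (rule bounded_linear_intro[where K = "cmod c"])
     (simp_all add: linear_add[OF linear_scaleC] linear_scale[OF linear_scaleC] norm_scaleC mult.commute)

lemma complex_linear_frac_power:
  fixes T :: "'a::complex_banach \<Rightarrow>\<^sub>L 'a"
  assumes "0 < s" "s < 1" "0 \<le> a" "a \<le> 1" "cesaro_bounded a T" and T: "complex_linear T"
  shows "complex_linear (frac_power a s T)"
  unfolding complex_linear_def
proof (intro allI)
  fix c x
  have sums: "(\<lambda>m. cesaro_kernel (- s) m *\<^sub>R blinfun_pow T m y) sums frac_power a s T y" for y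
    using bounded_linear.sums[OF blinfun.bounded_linear_left frac_power_sums[OF assms(1-5)]]
    by (simp add: blinfun.scaleR_left)
  have "(\<lambda>m. c *\<^sub>C (cesaro_kernel (- s) m *\<^sub>R blinfun_pow T m x)) sums (c *\<^sub>C frac_power a s T x)"
    by (rule bounded_linear.sums[OF bounded_linear_scaleC sums])
  moreover have "c *\<^sub>C (cesaro_kernel (- s) m *\<^sub>R blinfun_pow T m x)
      = cesaro_kernel (- s) m *\<^sub>R blinfun_pow T m (c *\<^sub>C x)" for m
    using complex_linear_blinfun_pow[OF T, of m]
    by (simp add: complex_linear_def linear_scale[OF linear_scaleC])
  ultimately show "frac_power a s T (c *\<^sub>C x) = c *\<^sub>C frac_power a s T x"
    using sums[of "c *\<^sub>C x"] sums_unique2 by auto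
qed

text \<open>The coefficients \<open>cesaro_kernel s n\<close> and \<open>L n\<^sup>s\<^sup>-\<^sup>1\<close> differ by \<open>O(n\<^sup>s\<^sup>-\<^sup>2)\<close>, while
  \<open>\<parallel>T\<^sup>n\<parallel> = O(n\<^sup>\<alpha>)\<close> with \<open>\<alpha> < 1 - s\<close>, so the two weighted series differ by an absolutely
  convergent one.\<close>

lemma binomial_partial_sum_eq_weighted:
  fixes T :: "'a::banach \<Rightarrow>\<^sub>L 'a"
  assumes s: "0 < s" "s < 1" and a: "0 \<le> a" "a < 1 - s" and T: "cesaro_bounded a T"
  obtains L e E where "L > 0" "e \<longlonglongrightarrow> E"
    "\<And>N. binomial_partial_sum s T N x = L *\<^sub>R weighted_partial_sum s T x N + e N"
proof -
  obtain L where L: "L > 0" "\<And>n. L * (real n + 1) powr (s - 1) \<le> cesaro_kernel s n"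
    "\<And>n. n \<ge> 1 \<Longrightarrow> cesaro_kernel s n \<le> L * real n powr (s - 1)"
    using cesaro_kernel_asymp[OF s] by blast
  obtain C where C: "C \<ge> 0" "\<And>N i. norm (\<Sum>l\<le>i. blinfun_pow T (Suc N + l))
        \<le> C * ((real N + 1 + real i) powr a * (real i + 1) powr (1 - a))"
    using cesaro_bounded_growth[of a T] s a T by auto
  define f where "f n = (cesaro_kernel s n - L * real n powr (s - 1)) *\<^sub>R blinfun_pow T n x" for n
  have f_le: "norm (f n) \<le> L * C * norm x * real n powr (s + a - 2)" if n: "n \<ge> 1" for n
  proof -
    obtain m where m: "n = Suc m" using n by (cases n) auto
    have pow: "norm (blinfun_pow T n x) \<le> C * real n powr a * norm x"
      using norm_blinfun[of "blinfun_pow T n" x] mult_right_mono[OF C(2)[where i = 0 and N = m], of "norm x"]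
      by (simp add: m add.commute)
    obtain z where z: "real n < z" "z < real n + 1"
      "(real n + 1) powr (s - 1) - real n powr (s - 1) = (s - 1) * z powr (s - 2)"
      using powr_Suc_diff_mvt[of "real n" "s - 1"] n by auto
    have "(1 - s) * z powr (s - 2) \<le> 1 * real n powr (s - 2)"
      using z s n by (intro mult_mono powr_mono2') auto
    moreover have "real n powr (s - 1) - (real n + 1) powr (s - 1) = (1 - s) * z powr (s - 2)"
      using z by (simp add: algebra_simps)
    ultimately have "L * (real n powr (s - 1) - (real n + 1) powr (s - 1)) \<le> L * real n powr (s - 2)"
      using L by (intro mult_left_mono) auto
    then have "\<bar>cesaro_kernel s n - L * real n powr (s - 1)\<bar> \<le> L * real n powr (s - 2)"
      using L(2)[of n] L(3)[OF n] by (simp add: right_diff_distrib)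
    then have "norm (f n) \<le> (L * real n powr (s - 2)) * (C * real n powr a * norm x)"
      unfolding f_def norm_scaleR using pow L by (intro mult_mono) auto
    also have "\<dots> = L * C * norm x * (real n powr (s - 2) * real n powr a)" by simp
    also have "\<dots> = L * C * norm x * real n powr (s + a - 2)"
      using n by (simp add: algebra_simps flip: powr_add)
    finally show ?thesis .
  qed
  have "summable f"
  proof (rule summable_comparison_test'[where N = 1])
    have "summable (\<lambda>n. real n powr (s + a - 2))"
      using s a by (subst summable_real_powr_iff) auto
    then show "summable (\<lambda>n. L * C * norm x * real n powr (s + a - 2))"
      by (rule summable_mult)
  qed (use f_le in auto)
  then have "(\<lambda>N. \<Sum>n\<le>N. f n) \<longlonglongrightarrow> suminf f" by (rule summable_LIMSEQ')
  moreover have "binomial_partial_sum s T N x = L *\<^sub>R weighted_partial_sum s T x N + (\<Sum>n\<le>N. f n)" for N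
  proof (induction N)
    case 0
    then show ?case by (simp add: binomial_partial_sum_apply weighted_partial_sum_def f_def)
  next
    case (Suc N)
    have "binomial_partial_sum s T (Suc N) x
        = binomial_partial_sum s T N x + cesaro_kernel s (Suc N) *\<^sub>R blinfun_pow T (Suc N) x"
      by (simp add: binomial_partial_sum_apply)
    moreover have "weighted_partial_sum s T x (Suc N)
        = weighted_partial_sum s T x N + real (Suc N) powr (s - 1) *\<^sub>R blinfun_pow T (Suc N) x"
    proof -
      have "1 / real (Suc N) powr (1 - s) = real (Suc N) powr (s - 1)"
        using powr_minus_divide[of "real (Suc N)" "1 - s"] by simp
      then show ?thesis by (simp add: weighted_partial_sum_def)
    qed
    ultimately show ?case
      using Suc by (simp add: f_def algebra_simps)
  qed
  ultimately show ?thesis using that[OF L(1)] by blast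
qed

theorem theorem3:
  fixes T :: "'a::complex_banach \<Rightarrow>\<^sub>L 'a" and s \<alpha> :: real and x :: 'a
  assumes "0 < s" and "s < 1" and "0 \<le> \<alpha>" and "\<alpha> < 1 - s"
    and "complex_linear T"
    and "cesaro_bounded \<alpha> T"
    and "closure (range (blinfun_apply (id_blinfun - T))) = UNIV"
  shows "(x \<in> range (blinfun_apply (frac_power \<alpha> s T))
            \<longleftrightarrow> convergent (weighted_partial_sum s T x))
       \<and> (convergent (weighted_partial_sum s T x)
            \<longleftrightarrow> weakly_convergent (weighted_partial_sum s T x))
       \<and> (x \<in> range (blinfun_apply (frac_power \<alpha> s T))
            \<or> convergent (weighted_partial_sum s T x)
          \<longrightarrow> (\<lambda>n. cesaro_kernel s n *\<^sub>R blinfun_pow T n x) sums frac_power_inv \<alpha> s T x)"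
proof -
  define A where "A = frac_power \<alpha> s T"
  define P where "P = binomial_partial_sum s T"
  define W where "W = weighted_partial_sum s T x"
  have \<alpha>1: "\<alpha> \<le> 1" using assms by simp
  have lim: "(\<lambda>N. P N (A y)) \<longlonglongrightarrow> y" for y
    unfolding P_def A_def using assms by (intro binomial_partial_sum_frac_power_tendsto) auto
  have comm: "A (P N y) = P N (A y)" for N y
    unfolding P_def A_def using assms \<alpha>1 by (intro binomial_partial_sum_commute_frac_power) auto
  have A_linear: "complex_linear A"
    unfolding A_def using assms \<alpha>1 by (intro complex_linear_frac_power) auto
  have "inj (blinfun_apply A)"
  proof (rule injI)
    fix y z assume "A y = A z"
    then show "y = z" using lim[of y] lim[of z] LIMSEQ_unique by metis
  qed
  then have inv: "frac_power_inv \<alpha> s T (A y) = y" for y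
    by (simp add: frac_power_inv_def A_def the_inv_f_f)
  obtain L e E where L: "L > 0" and e: "e \<longlonglongrightarrow> E" and PW: "\<And>N. P N x = L *\<^sub>R W N + e N"
    using binomial_partial_sum_eq_weighted[OF assms(1-4,6), of x] unfolding P_def W_def by metis
  have range_conv: "convergent W" if x: "x \<in> range (blinfun_apply A)"
  proof -
    obtain y where y: "x = A y" using x by blast
    have "(\<lambda>N. inverse L *\<^sub>R (P N x - e N)) \<longlonglongrightarrow> inverse L *\<^sub>R (y - E)"
      using lim[of y] e by (intro tendsto_intros) (simp_all add: y)
    moreover have "inverse L *\<^sub>R (P N x - e N) = W N" for N
      using L by (simp add: PW)
    ultimately show ?thesis by (auto simp: convergent_def)
  qed
  have conv_weak: "weakly_convergent W" if "convergent W"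
    using that unfolding convergent_def weakly_convergent_def
    by (blast intro: blinfun.tendsto[OF tendsto_const])
  have weak_range: "x \<in> range (blinfun_apply A)" if weak: "weakly_convergent W"
  proof -
    obtain w where w: "\<And>\<phi> :: 'a \<Rightarrow>\<^sub>L complex. complex_linear \<phi> \<Longrightarrow> (\<lambda>N. \<phi> (W N)) \<longlonglongrightarrow> \<phi> w"
      using weak unfolding weakly_convergent_def by blast
    define y where "y = L *\<^sub>R w + E"
    have "x = A y"
    proof (rule ccontr)
      assume "x \<noteq> A y"
      then have "x - A y \<noteq> 0" by simp
      then obtain \<phi> :: "'a \<Rightarrow>\<^sub>L complex" where \<phi>: "complex_linear \<phi>" "\<phi> (x - A y) \<noteq> 0"
        using exists_complex_functional_nonzero by blast
      define \<psi> where "\<psi> = \<phi> o\<^sub>L A"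
      have "complex_linear \<psi>"
        using \<phi>(1) A_linear by (simp add: \<psi>_def complex_linear_def)
      then have "(\<lambda>N. L *\<^sub>R \<psi> (W N) + \<psi> (e N)) \<longlonglongrightarrow> L *\<^sub>R \<psi> w + \<psi> E"
        by (intro tendsto_intros w e)
      moreover have "L *\<^sub>R \<psi> (W N) + \<psi> (e N) = \<phi> (P N (A x))" for N
        by (simp add: comm[symmetric] PW \<psi>_def blinfun.add_right blinfun.scaleR_right)
      moreover have "L *\<^sub>R \<psi> w + \<psi> E = \<phi> (A y)"
        by (simp add: y_def \<psi>_def blinfun.add_right blinfun.scaleR_right)
      ultimately have "(\<lambda>N. \<phi> (P N (A x))) \<longlonglongrightarrow> \<phi> (A y)" by simp
      moreover have "(\<lambda>N. \<phi> (P N (A x))) \<longlonglongrightarrow> \<phi> x"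
        by (intro tendsto_intros lim)
      ultimately have "\<phi> x = \<phi> (A y)" using LIMSEQ_unique by blast
      then show False using \<phi>(2) by (simp add: blinfun.diff_right)
    qed
    then show ?thesis by blast
  qed
  have "(\<lambda>n. cesaro_kernel s n *\<^sub>R blinfun_pow T n x) sums frac_power_inv \<alpha> s T x"
    if x: "x \<in> range (blinfun_apply A)"
  proof -
    obtain y where y: "x = A y" using x by blast
    have "(\<lambda>N. P N x) \<longlonglongrightarrow> y" using lim by (simp add: y)
    then have "(\<lambda>n. cesaro_kernel s n *\<^sub>R blinfun_pow T n x) sums y"
      by (simp add: P_def binomial_partial_sum_apply sums_def_le)
    then show ?thesis using inv[of y] by (simp add: y)
  qed
  then show ?thesis
    using range_conv conv_weak weak_range unfolding A_def W_def by blast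
qed

end
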